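(* Let $\alpha>0$ and $(\Sigma_n)_n\in\mathrm{CovMat}(\alpha)$ be arbitrary, and let $(a_n)_{n\in\mathbb N}$ be a Gaussian triangular scheme constructed with respect to $\alpha$ and $(\Sigma_n)_n$ (as defined in the context). Then $(a_n)_n$ is strongly $\alpha$-almost uncorrelated, and if $\alpha>\frac14$, then for all $l\in\mathbb N$ the sequences $C^{(l)}_n$ and $D^{(l)}_n$ in the definition of strongly $\alpha$-almost uncorrelated can be chosen summable over $n$. Further, this property is tight in the sense that $(a_n)_n$ need not be $\alpha'$-almost uncorrelated for any $\alpha'>\alpha$; that is, for every $\alpha>0$ and every $\alpha'>\alpha$ there are $(\Sigma_n)_n\in\mathrm{CovMat}(\alpha)$ and a Gaussian triangular scheme constructed with respect to $\alpha$ and $(\Sigma_n)_n$ that is not $\alpha'$-almost uncorrelated.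
   Context: $\mathbb N=\{1,2,\dots\}$, $[n]=\{1,\dots,n\}$, $\square_n=[n]\times[n]$, $\Delta_n=n(n+1)/2$. All random variables are defined on a common probability space with expectation $\mathbb E$. For $\alpha>0$, $\mathrm{CovMat}(\alpha)$ is the set of all sequences $(\Sigma_n)_n$ where each $\Sigma_n$ is a real symmetric positive definite $n\times n$ matrix with $\Sigma_n(i,i)=1$ for all $i\in[n]$ and $|\Sigma_n(i,j)|\le n^{-\alpha}$ for all $i\ne j$ in $[n]$. Gaussian triangular scheme constructed with respect to $\alpha$ and $(\Sigma_n)_n\in\mathrm{CovMat}(\alpha)$: for each $n$ let $(Y^{(n)}_1,\dots,Y^{(n)}_{\Delta_n})\sim\mathcal N(0,\Sigma_{\Delta_n})$, fix a map $\varphi_n:\square_n\to[\Delta_n]$ whose restriction to $\{(i,j)\in\square_n:i\le j\}$ is a bijection and which satisfies $\varphi_n(i,j)=\varphi_n(j,i)$ for all $(i,j)\in\square_n$ with $j<i$, and set $a_n(i,j)=Y^{(n)}_{\varphi_n(i,j)}$ for all $(i,j)\in\square_n$. A triangular scheme is a sequence $(a_n)_{n\in\mathbb N}$ where each $a_n=(a_n(p,q))_{(p,q)\in\square_n}$ is a symmetric $n\times n$ matrix of real-valued random variables. Pairs $(a,b),(c,d)\in\mathbb N^2$ are fundamentally different if $\{a,b\}\ne\{c,d\}$; several pairs are called fundamentally different if they are pairwise so. Let $\alpha>0$. A triangular scheme $(a_n)_n$ is $\alpha$-almost uncorrelated if (all moments of the entries exist and) there are sequences of constants $(C_k)_k$,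 $(C^{(m)}_n)_{n,m}$, $(D^{(m)}_n)_{n,m}$ with $\lim_{n\to\infty}C^{(m)}_n=0$ and $\lim_{n\to\infty}D^{(m)}_n=0$ for each $m\in\mathbb N$, such that for all $N,l\in\mathbb N$ and all fundamentally different pairs $(p_1,q_1),\dots,(p_l,q_l)\in\square_N$: (AAU1) for all $\delta_1,\dots,\delta_l\in\mathbb N$ and all $n\ge N$: $|\mathbb E\, a_n(p_1,q_1)^{\delta_1}\cdots a_n(p_l,q_l)^{\delta_l}|\le C_{\delta_1+\dots+\delta_l}\, n^{-\alpha\cdot\#\{i\in\{1,\dots,l\}:\delta_i=1\}}$; (AAU2) for all $n\ge N$: $|\mathbb E\, a_n(p_1,q_1)^2\cdots a_n(p_l,q_l)^2-1|\le C^{(l)}_n$. It is strongly $\alpha$-almost uncorrelated if additionally (AAU3) for all $n\ge N$: $|\mathbb E\, a_n(p_1,q_1)^4\,(a_n(p_2,q_2)^2\cdots a_n(p_l,q_l)^2-1)|\le D^{(l)}_n$ (an empty product equals $1$). *)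

theory Defs
  imports "HOL-Probability.Probability"
begin

text \<open>
  Vectors and matrices of varying size are functions on \<open>nat\<close>, of which only the values at
  indices in \<open>{1..n}\<close> matter. Sequences over the positive integers are functions on \<open>nat\<close>
  whose value at \<open>0\<close> is irrelevant.
\<close>

definition quad_form :: "nat \<Rightarrow> (nat \<Rightarrow> nat \<Rightarrow> real) \<Rightarrow> (nat \<Rightarrow> real) \<Rightarrow> real" where
  "quad_form d S t = (\<Sum>i=1..d. \<Sum>j=1..d. t i * S i j * t j)"

definition sym_pos_def :: "nat \<Rightarrow> (nat \<Rightarrow> nat \<Rightarrow> real) \<Rightarrow> bool" where
  "sym_pos_def d S \<longleftrightarrow>
     (\<forall>i\<in>{1..d}. \<forall>j\<in>{1..d}. S i j = S j i) \<and>
     (\<forall>t. (\<exists>i\<in>{1..d}. t i \<noteq> 0) \<longrightarrow> quad_form d S t > 0)"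

definition CovMat :: "real \<Rightarrow> (nat \<Rightarrow> nat \<Rightarrow> nat \<Rightarrow> real) set" where
  "CovMat \<alpha> = {S. \<forall>n\<ge>1. sym_pos_def n (S n) \<and>
     (\<forall>i\<in>{1..n}. S n i i = 1) \<and>
     (\<forall>i\<in>{1..n}. \<forall>j\<in>{1..n}. i \<noteq> j \<longrightarrow> \<bar>S n i j\<bar> \<le> real n powr (-\<alpha>))}"

text \<open>
  \<open>(Y 1, \<dots>, Y d)\<close> has the multivariate normal law with mean zero and covariance matrix \<open>S\<close>:
  the law on $\mathbb{R}^d$ with characteristic function \<open>t \<mapsto> exp (- t\<^sup>T S t / 2)\<close>.
\<close>

definition centered_gaussian ::
    "'w measure \<Rightarrow> nat \<Rightarrow> (nat \<Rightarrow> nat \<Rightarrow> real) \<Rightarrow> (nat \<Rightarrow> 'w \<Rightarrow> real) \<Rightarrow> bool" where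
  "centered_gaussian M d S Y \<longleftrightarrow>
     (\<forall>i\<in>{1..d}. Y i \<in> borel_measurable M) \<and>
     (\<forall>t. (CLINT \<omega>|M. iexp (\<Sum>i=1..d. t i * Y i \<omega>)) = complex_of_real (exp (- quad_form d S t / 2)))"

definition square :: "nat \<Rightarrow> (nat \<times> nat) set" where
  "square n = {1..n} \<times> {1..n}"

definition triangle :: "nat \<Rightarrow> nat" where
  "triangle n = n * (n + 1) div 2"

definition triangular_scheme :: "'w measure \<Rightarrow> (nat \<Rightarrow> nat \<Rightarrow> nat \<Rightarrow> 'w \<Rightarrow> real) \<Rightarrow> bool" where
  "triangular_scheme M a \<longleftrightarrow>
     (\<forall>n\<ge>1. \<forall>(p, q)\<in>square n. a n p q \<in> borel_measurable M \<and>
        (\<forall>\<omega>\<in>space M. a n p q \<omega> = a n q p \<omega>))"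

definition gaussian_triangular_scheme ::
    "'w measure \<Rightarrow> (nat \<Rightarrow> nat \<Rightarrow> nat \<Rightarrow> real) \<Rightarrow> (nat \<Rightarrow> nat \<Rightarrow> nat \<Rightarrow> 'w \<Rightarrow> real) \<Rightarrow> bool" where
  "gaussian_triangular_scheme M S a \<longleftrightarrow>
     (\<forall>n\<ge>1. \<exists>Y \<phi>.
        centered_gaussian M (triangle n) (S (triangle n)) Y \<and>
        \<phi> \<in> square n \<rightarrow> {1..triangle n} \<and>
        bij_betw \<phi> {(i, j) \<in> square n. i \<le> j} {1..triangle n} \<and>
        (\<forall>(i, j)\<in>square n. j < i \<longrightarrow> \<phi> (i, j) = \<phi> (j, i)) \<and>
        (\<forall>(i, j)\<in>square n. \<forall>\<omega>\<in>space M. a n i j \<omega> = Y (\<phi> (i, j)) \<omega>))"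

text \<open>The pairs \<open>(p 1, q 1), \<dots>, (p l, q l)\<close> lie in \<open>square N\<close> and are fundamentally different.\<close>

definition fund_diff_pairs :: "nat \<Rightarrow> nat \<Rightarrow> (nat \<Rightarrow> nat) \<Rightarrow> (nat \<Rightarrow> nat) \<Rightarrow> bool" where
  "fund_diff_pairs N l p q \<longleftrightarrow>
     (\<forall>i\<in>{1..l}. (p i, q i) \<in> square N) \<and>
     (\<forall>i\<in>{1..l}. \<forall>j\<in>{1..l}. i \<noteq> j \<longrightarrow> {p i, q i} \<noteq> {p j, q j})"

definition moments_exist :: "'w measure \<Rightarrow> (nat \<Rightarrow> nat \<Rightarrow> nat \<Rightarrow> 'w \<Rightarrow> real) \<Rightarrow> bool" where
  "moments_exist M a \<longleftrightarrow>
     (\<forall>n\<ge>1. \<forall>(p, q)\<in>square n. \<forall>k::nat. integrable M (\<lambda>\<omega>. a n p q \<omega> ^ k))"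

definition AAU1 ::
    "'w measure \<Rightarrow> real \<Rightarrow> (nat \<Rightarrow> nat \<Rightarrow> nat \<Rightarrow> 'w \<Rightarrow> real) \<Rightarrow> (nat \<Rightarrow> real) \<Rightarrow> bool" where
  "AAU1 M \<alpha> a C \<longleftrightarrow>
     (\<forall>N\<ge>1. \<forall>l\<ge>1. \<forall>p q. fund_diff_pairs N l p q \<longrightarrow>
        (\<forall>\<delta>. (\<forall>i\<in>{1..l}. \<delta> i \<ge> 1) \<longrightarrow> (\<forall>n\<ge>N.
           \<bar>LINT \<omega>|M. (\<Prod>i=1..l. a n (p i) (q i) \<omega> ^ \<delta> i)\<bar>
             \<le> C (\<Sum>i=1..l. \<delta> i) * real n powr (- \<alpha> * real (card {i\<in>{1..l}. \<delta> i = 1})))))"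

text \<open>In the families \<open>C'\<close> and \<open>D\<close> below, the first argument is the superscript.\<close>

definition AAU2 ::
    "'w measure \<Rightarrow> (nat \<Rightarrow> nat \<Rightarrow> nat \<Rightarrow> 'w \<Rightarrow> real) \<Rightarrow> (nat \<Rightarrow> nat \<Rightarrow> real) \<Rightarrow> bool" where
  "AAU2 M a C' \<longleftrightarrow>
     (\<forall>N\<ge>1. \<forall>l\<ge>1. \<forall>p q. fund_diff_pairs N l p q \<longrightarrow> (\<forall>n\<ge>N.
        \<bar>(LINT \<omega>|M. (\<Prod>i=1..l. (a n (p i) (q i) \<omega>)\<^sup>2)) - 1\<bar> \<le> C' l n))"

definition AAU3 ::
    "'w measure \<Rightarrow> (nat \<Rightarrow> nat \<Rightarrow> nat \<Rightarrow> 'w \<Rightarrow> real) \<Rightarrow> (nat \<Rightarrow> nat \<Rightarrow> real) \<Rightarrow> bool" where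
  "AAU3 M a D \<longleftrightarrow>
     (\<forall>N\<ge>1. \<forall>l\<ge>1. \<forall>p q. fund_diff_pairs N l p q \<longrightarrow> (\<forall>n\<ge>N.
        \<bar>LINT \<omega>|M. a n (p 1) (q 1) \<omega> ^ 4 * ((\<Prod>i=2..l. (a n (p i) (q i) \<omega>)\<^sup>2) - 1)\<bar> \<le> D l n))"

definition almost_uncorrelated_with ::
    "'w measure \<Rightarrow> real \<Rightarrow> (nat \<Rightarrow> nat \<Rightarrow> nat \<Rightarrow> 'w \<Rightarrow> real) \<Rightarrow>
     (nat \<Rightarrow> real) \<Rightarrow> (nat \<Rightarrow> nat \<Rightarrow> real) \<Rightarrow> bool" where
  "almost_uncorrelated_with M \<alpha> a C C' \<longleftrightarrow>
     triangular_scheme M a \<and> moments_exist M a \<and>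
     (\<forall>m\<ge>1. C' m \<longlonglongrightarrow> 0) \<and> AAU1 M \<alpha> a C \<and> AAU2 M a C'"

definition strongly_almost_uncorrelated_with ::
    "'w measure \<Rightarrow> real \<Rightarrow> (nat \<Rightarrow> nat \<Rightarrow> nat \<Rightarrow> 'w \<Rightarrow> real) \<Rightarrow>
     (nat \<Rightarrow> real) \<Rightarrow> (nat \<Rightarrow> nat \<Rightarrow> real) \<Rightarrow> (nat \<Rightarrow> nat \<Rightarrow> real) \<Rightarrow> bool" where
  "strongly_almost_uncorrelated_with M \<alpha> a C C' D \<longleftrightarrow>
     almost_uncorrelated_with M \<alpha> a C C' \<and> (\<forall>m\<ge>1. D m \<longlonglongrightarrow> 0) \<and> AAU3 M a D"

definition almost_uncorrelated ::
    "'w measure \<Rightarrow> real \<Rightarrow> (nat \<Rightarrow> nat \<Rightarrow> nat \<Rightarrow> 'w \<Rightarrow> real) \<Rightarrow> bool" where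
  "almost_uncorrelated M \<alpha> a \<longleftrightarrow> (\<exists>C C'. almost_uncorrelated_with M \<alpha> a C C')"

definition strongly_almost_uncorrelated ::
    "'w measure \<Rightarrow> real \<Rightarrow> (nat \<Rightarrow> nat \<Rightarrow> nat \<Rightarrow> 'w \<Rightarrow> real) \<Rightarrow> bool" where
  "strongly_almost_uncorrelated M \<alpha> a \<longleftrightarrow>
     (\<exists>C C' D. strongly_almost_uncorrelated_with M \<alpha> a C C' D)"

end

theory Submission
  imports Defs
begin

text \<open>
  Write $\eta_n = \Delta_n^{-\alpha/2}$, so that the off-diagonal covariances at stage \<open>n\<close> are at
  most $\eta_n^2$ and $\eta_n = O(n^{-\alpha})$. Wick's recursion
  $E\,Y_k Y^e = \sum_j e_j \Sigma(k,j)\, E\,Y^{e-\delta_j}$ bounds a moment by $\eta_n$ to the number of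
  indices of odd multiplicity: pairing \<open>k\<close> with \<open>j \<noteq> k\<close> costs $\eta_n^2$ and lowers that number by
  at most two. Counting odd multiplicities rather than multiplicities equal to one matters:
  adding a square $Y_k^2$ to an even monomial then changes its expectation by only
  $O(\eta_n^4) = O(n^{-4\alpha})$, which is summable as soon as $\alpha > 1/4$. For the tightness, a
  single off-diagonal covariance of maximal size suffices.
\<close>

text \<open>The Gaussian law is given only through its characteristic function: there is no density
  to integrate by parts against, and no moment is known to exist at the outset. Hence the detour
  before Wick's recursion. Restricting the characteristic function to one coordinate axis identifies
  each marginal as standard normal, which makes all monomials integrable; this in turn permits
  repeated differentiation of the characteristic function under the integral. The square root in
  \<open>\<eta>\<close> reflects that a covariance is always shared by the two indices it pairs, so
  each index pays half. Since \<Delta>_n is about n^2/2, a covariance bounded by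
  \<Delta>_n^(-\<alpha>) has order n^(-2\<alpha>), that is n^(-\<alpha>) per index, exactly the rate
  demanded by AAU1. The same computation shows why no better rate is possible: a covariance equal to
  \<Delta>_n^(-\<alpha>) is at least n^(-2\<alpha>), since \<Delta>_n is at most n^2, while two
  factors of multiplicity one would have to give O(n^(-2\<alpha>')).\<close>

section \<open>Differentiation under the integral sign\<close>

lemma has_vector_derivative_at_0_quadratic_bound:
  fixes f :: "real \<Rightarrow> 'a::real_normed_vector"
  assumes "\<And>h. norm (f h - f 0 - h *\<^sub>R D) \<le> K * h\<^sup>2"
  shows "(f has_vector_derivative D) (at 0)"
proof -
  have K: "K \<ge> 0"
    using order_trans[OF norm_ge_zero assms[of 1]] by simp
  have "((\<lambda>h. norm (f h - f 0 - h *\<^sub>R D) / \<bar>h\<bar>) \<longlongrightarrow> 0) (at 0)"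
  proof (rule Lim_null_comparison)
    show "\<forall>\<^sub>F h in at 0. norm (norm (f h - f 0 - h *\<^sub>R D) / \<bar>h\<bar>) \<le> K * \<bar>h\<bar>"
    proof (rule always_eventually, rule allI)
      fix h :: real
      have "norm (f h - f 0 - h *\<^sub>R D) / \<bar>h\<bar> \<le> K * \<bar>h\<bar>" if "h \<noteq> 0"
        using that assms[of h]
        by (simp add: divide_le_eq power2_eq_square mult.assoc flip: abs_mult)
      thus "norm (norm (f h - f 0 - h *\<^sub>R D) / \<bar>h\<bar>) \<le> K * \<bar>h\<bar>"
        using K by (cases "h = 0") auto
    qed
    show "((\<lambda>h. K * \<bar>h\<bar>) \<longlongrightarrow> 0) (at 0)"
      by real_asymp
  qed
  thus ?thesis
    by (simp add: has_vector_derivative_def has_derivative_at bounded_linear_scaleR_left)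
qed

text \<open>No dominated convergence is involved: pointwise |exp(ihX) - 1 - ihX| is at most h^2 X^2
  / 2, so the error of the linear approximation is at most h^2 E|G X^2| / 2. This is where
  \<open>GX2\<close> enters, in addition to \<open>GX\<close>, which makes the derivative itself
  meaningful.\<close>

lemma has_vector_derivative_integral_iexp:
  fixes G X \<theta> :: "'a \<Rightarrow> real"
  assumes G: "integrable M G" and GX: "integrable M (\<lambda>\<omega>. G \<omega> * X \<omega>)"
    and GX2: "integrable M (\<lambda>\<omega>. G \<omega> * (X \<omega>)\<^sup>2)"
    and [measurable]: "X \<in> borel_measurable M" "\<theta> \<in> borel_measurable M"
  shows "((\<lambda>h. CLINT \<omega>|M. complex_of_real (G \<omega>) * iexp (\<theta> \<omega> + h * X \<omega>))
           has_vector_derivative \<i> * (CLINT \<omega>|M. complex_of_real (G \<omega> * X \<omega>) * iexp (\<theta> \<omega>))) (at 0)"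
proof (rule has_vector_derivative_at_0_quadratic_bound)
  fix h :: real
  have [measurable]: "G \<in> borel_measurable M"
    using G by auto
  have i1: "integrable M (\<lambda>\<omega>. complex_of_real (F \<omega>) * iexp (\<theta> \<omega> + c * X \<omega>))"
    if "integrable M F" for F c
  proof (rule Bochner_Integration.integrable_bound[OF that])
    have [measurable]: "F \<in> borel_measurable M"
      using that by auto
    show "(\<lambda>\<omega>. complex_of_real (F \<omega>) * iexp (\<theta> \<omega> + c * X \<omega>)) \<in> borel_measurable M"
      by measurable
  qed (simp add: norm_mult)
  let ?r = "\<lambda>\<omega>. complex_of_real (G \<omega>) * iexp (\<theta> \<omega>) * (iexp (h * X \<omega>) - (1 + \<i> * (h * X \<omega>)))"
  have r: "?r \<omega> = complex_of_real (G \<omega>) * iexp (\<theta> \<omega> + h * X \<omega>)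
      - complex_of_real (G \<omega>) * iexp (\<theta> \<omega> + 0 * X \<omega>)
      - h *\<^sub>R (\<i> * (complex_of_real (G \<omega> * X \<omega>) * iexp (\<theta> \<omega> + 0 * X \<omega>)))" for \<omega>
    by (simp add: algebra_simps exp_add scaleR_conv_of_real)
  have int_r: "integrable M ?r"
    unfolding r by (intro Bochner_Integration.integrable_diff integrable_scaleR_right
        integrable_mult_right i1 G GX)
  have "(CLINT \<omega>|M. complex_of_real (G \<omega>) * iexp (\<theta> \<omega> + h * X \<omega>))
      - (CLINT \<omega>|M. complex_of_real (G \<omega>) * iexp (\<theta> \<omega> + 0 * X \<omega>))
      - h *\<^sub>R (\<i> * (CLINT \<omega>|M. complex_of_real (G \<omega> * X \<omega>) * iexp (\<theta> \<omega>))) = (CLINT \<omega>|M. ?r \<omega>)"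
    unfolding r using i1[OF G, of h] i1[OF G, of 0] i1[OF GX, of 0]
    by (simp add: Bochner_Integration.integral_diff)
  also have "norm \<dots> \<le> (LINT \<omega>|M. norm (?r \<omega>))"
    by (rule integral_norm_bound)
  also have "\<dots> \<le> (LINT \<omega>|M. h\<^sup>2 / 2 * \<bar>G \<omega> * (X \<omega>)\<^sup>2\<bar>)"
  proof (rule integral_mono)
    show "integrable M (\<lambda>\<omega>. norm (?r \<omega>))"
      using int_r by (rule integrable_norm)
    show "integrable M (\<lambda>\<omega>. h\<^sup>2 / 2 * \<bar>G \<omega> * (X \<omega>)\<^sup>2\<bar>)"
      using GX2 by (intro integrable_mult_right integrable_abs)
    fix \<omega>
    have "cmod (iexp (h * X \<omega>) - (1 + \<i> * (h * X \<omega>))) \<le> \<bar>h * X \<omega>\<bar>\<^sup>2 / 2"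
      using iexp_approx1[of "h * X \<omega>" 1] by (simp add: numeral_2_eq_2)
    hence "\<bar>G \<omega>\<bar> * cmod (iexp (h * X \<omega>) - (1 + \<i> * (h * X \<omega>)))
        \<le> \<bar>G \<omega>\<bar> * (\<bar>h * X \<omega>\<bar>\<^sup>2 / 2)"
      by (rule mult_left_mono) simp
    hence "norm (?r \<omega>) \<le> \<bar>G \<omega>\<bar> * (\<bar>h * X \<omega>\<bar>\<^sup>2 / 2)"
      by (simp add: norm_mult)
    thus "norm (?r \<omega>) \<le> h\<^sup>2 / 2 * \<bar>G \<omega> * (X \<omega>)\<^sup>2\<bar>"
      by (simp add: abs_mult power_mult_distrib mult_ac)
  qed
  also have "\<dots> = (LINT \<omega>|M. \<bar>G \<omega> * (X \<omega>)\<^sup>2\<bar>) / 2 * h\<^sup>2"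
    by simp
  finally show "norm ((CLINT \<omega>|M. complex_of_real (G \<omega>) * iexp (\<theta> \<omega> + h * X \<omega>))
      - (CLINT \<omega>|M. complex_of_real (G \<omega>) * iexp (\<theta> \<omega> + 0 * X \<omega>))
      - h *\<^sub>R (\<i> * (CLINT \<omega>|M. complex_of_real (G \<omega> * X \<omega>) * iexp (\<theta> \<omega>))))
     \<le> (LINT \<omega>|M. \<bar>G \<omega> * (X \<omega>)\<^sup>2\<bar>) / 2 * h\<^sup>2" .
qed

section \<open>Linear and quadratic forms under a shift of one coordinate\<close>

text \<open>Symmetry of \<open>S\<close> merges the two cross terms into the factor 2. The formula
  exposes the dependence on \<open>h\<close>, so that exp(-Q/2) can be differentiated along
  coordinate \<open>k\<close>.\<close>

lemma quad_form_fun_upd: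
  assumes "\<And>i j. i \<in> {1..d} \<Longrightarrow> j \<in> {1..d} \<Longrightarrow> S i j = S j i" "k \<in> {1..d}"
  shows "quad_form d S (t(k := t k + h)) =
    quad_form d S t + 2 * h * (\<Sum>j=1..d. S k j * t j) + h\<^sup>2 * S k k"
proof -
  define u :: "nat \<Rightarrow> real" where "u i = (if i = k then h else 0)" for i
  have u: "t(k := t k + h) = (\<lambda>i. t i + u i)"
    by (auto simp: u_def)
  have u_sum: "(\<Sum>i=1..d. u i * f i) = h * f k" for f
    using assms(2) by (simp add: u_def if_distrib[of "\<lambda>x. x * _"] sum.delta cong: if_cong)
  have "quad_form d S (t(k := t k + h)) = quad_form d S t
      + (\<Sum>i=1..d. u i * (\<Sum>j=1..d. S i j * t j))
      + (\<Sum>i=1..d. t i * (\<Sum>j=1..d. u j * S i j))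
      + (\<Sum>i=1..d. u i * (\<Sum>j=1..d. u j * S i j))"
    unfolding u quad_form_def
    by (simp add: algebra_simps sum.distrib sum_distrib_left)
  also have "(\<Sum>i=1..d. t i * (\<Sum>j=1..d. u j * S i j)) = h * (\<Sum>j=1..d. S k j * t j)"
    unfolding u_sum sum_distrib_left using assms by (intro sum.cong) auto
  finally show ?thesis
    unfolding u_sum by (simp add: power2_eq_square fun_upd_def)
qed

lemma sum_fun_upd_add:
  fixes t f :: "nat \<Rightarrow> real"
  assumes "k \<in> {1..d}"
  shows "(\<Sum>i=1..d. (t(k := t k + h)) i * f i) = (\<Sum>i=1..d. t i * f i) + h * f k"
proof -
  have "(\<Sum>i=1..d. (t(k := t k + h)) i * f i) =
      (\<Sum>i=1..d. t i * f i + (if i = k then h * f k else 0))"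
    by (intro sum.cong) (auto simp: algebra_simps)
  thus ?thesis
    using assms by (simp add: sum.distrib)
qed

lemma sum_scaled_fun_upd_add:
  fixes t f :: "nat \<Rightarrow> real"
  assumes "k \<in> {1..d}"
  shows "(\<Sum>i=1..d. f i * (t(k := t k + h)) i) = (\<Sum>i=1..d. f i * t i) + f k * h"
  using sum_fun_upd_add[OF assms, of t h f] by (simp only: mult.commute)

section \<open>Multisets of indices and their parities\<close>

definition odd_part :: "'a multiset \<Rightarrow> 'a set" where
  "odd_part e = {i. odd (count e i)}"

lemma finite_odd_part [simp]: "finite (odd_part e)"
  by (rule finite_subset[OF _ finite_set_mset[of e]]) (auto simp: odd_part_def elim: oddE intro: count_inI)

lemma size_sum:
  fixes F :: "'a \<Rightarrow> 'b multiset"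
  shows "size (\<Sum>i\<in>A. F i) = (\<Sum>i\<in>A. size (F i))"
  by (induction A rule: infinite_finite_induct) auto

lemma abs_sum_mset_le:
  fixes f :: "'b \<Rightarrow> real"
  assumes "\<And>x. x \<in># e \<Longrightarrow> \<bar>f x\<bar> \<le> B"
  shows "\<bar>\<Sum>x\<in>#e. f x\<bar> \<le> real (size e) * B"
  using assms
proof (induction e)
  case (add x e)
  have "\<bar>f x + (\<Sum>x\<in>#e. f x)\<bar> \<le> \<bar>f x\<bar> + \<bar>\<Sum>x\<in>#e. f x\<bar>"
    by (rule abs_triangle_ineq)
  also have "\<dots> \<le> B + real (size e) * B"
    using add by (intro add_mono) auto
  finally show ?case
    by (simp add: algebra_simps)
qed simp

lemma of_real_sum_mset: "of_real (\<Sum>x\<in>#e. f x) = (\<Sum>x\<in>#e. of_real (f x))"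
  by (induction e) auto

section \<open>Wick recursion for Gaussian vectors\<close>

locale gaussian_vector = prob_space M
  for M :: "'w measure" and d S Y +
  assumes gaussian: "centered_gaussian M d S Y"
    and S_sym: "\<And>i j. i \<in> {1..d} \<Longrightarrow> j \<in> {1..d} \<Longrightarrow> S i j = S j i"
    and S_diag: "\<And>i. i \<in> {1..d} \<Longrightarrow> S i i = 1"
begin

lemma Y_measurable: "i \<in> {1..d} \<Longrightarrow> Y i \<in> borel_measurable M"
  using gaussian by (simp add: centered_gaussian_def)

lemma char_Y: "(CLINT \<omega>|M. iexp (\<Sum>i=1..d. t i * Y i \<omega>)) = complex_of_real (exp (- quad_form d S t / 2))"
  using gaussian by (simp add: centered_gaussian_def)

text \<open>For \<open>t\<close> supported on coordinate \<open>k\<close> the characteristic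
  function reduces to exp(-x^2/2) because \<open>S k k\<close> is 1, and Levy's uniqueness theorem
  does the rest. All integrability of monomials stems from this.\<close>

lemma distr_Y:
  assumes k: "k \<in> {1..d}"
  shows "distr M borel (Y k) = std_normal_distribution"
proof (rule Levy_uniqueness)
  note [measurable] = Y_measurable[OF k]
  show "real_distribution (distr M borel (Y k))"
    by simp
  show "real_distribution std_normal_distribution"
    by (rule real_dist_normal_dist)
  show "char (distr M borel (Y k)) = char std_normal_distribution"
  proof
    fix x
    \<comment> \<open>The point \<open>x\<close> on axis \<open>k\<close> is written as a shift of
      the zero vector, with value \<open>0 + x\<close>, to fit the form \<open>t k + h\<close> of
      the shift lemmas.\<close>
    have *: "(\<Sum>i=1..d. ((\<lambda>_. 0)(k := 0 + x)) i * Y i \<omega>) = x * Y k \<omega>" for \<omega>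
      by (subst sum_fun_upd_add[OF k]) simp
    have "char (distr M borel (Y k)) x = (CLINT \<omega>|M. iexp (x * Y k \<omega>))"
      by (simp add: char_def integral_distr)
    also have "\<dots> = complex_of_real (exp (- quad_form d S ((\<lambda>_. 0)(k := 0 + x)) / 2))"
      unfolding char_Y[symmetric] * ..
    also have "quad_form d S ((\<lambda>_. 0)(k := 0 + x)) = x\<^sup>2"
      using quad_form_fun_upd[OF S_sym k, where t = "\<lambda>_. 0" and h = x] S_diag[OF k] by (simp add: quad_form_def)
    finally show "char (distr M borel (Y k)) x = char std_normal_distribution x"
      by (simp add: char_std_normal_distribution)
  qed
qed

lemma integrable_Y_power:
  assumes "k \<in> {1..d}"
  shows "integrable M (\<lambda>\<omega>. Y k \<omega> ^ m)"
proof -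
  have "integrable (distr M borel (Y k)) (\<lambda>x. x ^ m)"
    unfolding distr_Y[OF assms]
    using integrable_std_normal_distribution_moment by blast
  thus ?thesis
    using Y_measurable[OF assms] by (simp add: integrable_distr_eq)
qed

text \<open>Multisets as exponents make Wick's sum over the remaining factors a plain multiset sum,
  which counts multiplicities by itself, and turn deletion of a factor into multiset
  difference.\<close>

definition monomial :: "nat multiset \<Rightarrow> 'w \<Rightarrow> real" where
  "monomial e \<omega> = (\<Prod>x\<in>#e. Y x \<omega>)"

lemma monomial_empty [simp]: "monomial {#} = (\<lambda>_. 1)"
  by (simp add: monomial_def fun_eq_iff)

lemma monomial_add_mset [simp]: "monomial (add_mset k e) = (\<lambda>\<omega>. Y k \<omega> * monomial e \<omega>)"
  by (simp add: monomial_def fun_eq_iff)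

lemma monomial_plus: "monomial (e + f) \<omega> = monomial e \<omega> * monomial f \<omega>"
  by (simp add: monomial_def)

lemma monomial_replicate: "monomial (replicate_mset n k) \<omega> = Y k \<omega> ^ n"
  by (simp add: monomial_def)

lemma monomial_sum: "monomial (\<Sum>i\<in>A. F i) \<omega> = (\<Prod>i\<in>A. monomial (F i) \<omega>)"
  by (induction A rule: infinite_finite_induct) (auto simp: monomial_plus)

text \<open>All powers are treated at once because the induction step needs a higher one: |xy|^m is
  at most x^(2m) + y^(2m), so the m-th power of a product is controlled by the 2m-th powers of its
  factors.\<close>

lemma monomial_moments:
  assumes "set_mset e \<subseteq> {1..d}"
  shows "monomial e \<in> borel_measurable M \<and> (\<forall>m. integrable M (\<lambda>\<omega>. monomial e \<omega> ^ m))"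
  using assms
proof (induction e)
  case (add k e)
  hence k: "k \<in> {1..d}" and meas [measurable]: "monomial e \<in> borel_measurable M"
    and int: "\<And>m. integrable M (\<lambda>\<omega>. monomial e \<omega> ^ m)"
    by auto
  note [measurable] = Y_measurable[OF k]
  have "integrable M (\<lambda>\<omega>. (Y k \<omega> * monomial e \<omega>) ^ m)" for m
  proof (rule Bochner_Integration.integrable_bound)
    show "integrable M (\<lambda>\<omega>. Y k \<omega> ^ (2 * m) + monomial e \<omega> ^ (2 * m))"
      by (intro Bochner_Integration.integrable_add integrable_Y_power[OF k] int)
    have "\<bar>x * y\<bar> \<le> x\<^sup>2 + y\<^sup>2" for x y :: real
      using sum_squares_bound[of "\<bar>x\<bar>" "\<bar>y\<bar>"] abs_ge_zero[of "x * y"]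
      by (simp only: abs_mult power2_abs)
    hence "\<bar>x ^ m * y ^ m\<bar> \<le> x ^ (2 * m) + y ^ (2 * m)" for x y :: real
      by (simp add: power_mult mult.commute)
    thus "AE \<omega> in M. norm ((Y k \<omega> * monomial e \<omega>) ^ m)
        \<le> norm (Y k \<omega> ^ (2 * m) + monomial e \<omega> ^ (2 * m))"
      by (simp add: power_mult_distrib)
  qed measurable
  thus ?case
    by simp
qed auto

lemma integrable_monomial: "set_mset e \<subseteq> {1..d} \<Longrightarrow> integrable M (monomial e)"
  using monomial_moments[of e] by (auto dest: spec[of _ 1])

text \<open>Up to a power of i, the partial derivative of the characteristic function along the
  indices in \<open>e\<close>. The empty multiset gives the characteristic function itself, and t =
  0 gives the moment.\<close>

definition char_monomial :: "nat multiset \<Rightarrow> (nat \<Rightarrow> real) \<Rightarrow> complex" where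
  "char_monomial e t = (CLINT \<omega>|M. complex_of_real (monomial e \<omega>) * iexp (\<Sum>i=1..d. t i * Y i \<omega>))"

lemma char_monomial_derivative:
  assumes e: "set_mset e \<subseteq> {1..d}" and k: "k \<in> {1..d}"
  shows "((\<lambda>h. char_monomial e (t(k := t k + h)))
           has_vector_derivative \<i> * char_monomial (add_mset k e) t) (at 0)"
proof -
  note [measurable] = Y_measurable
  have 1: "integrable M (\<lambda>\<omega>. monomial e \<omega> * Y k \<omega>)"
    using integrable_monomial[of "add_mset k e"] e k by (simp add: mult.commute)
  have 2: "integrable M (\<lambda>\<omega>. monomial e \<omega> * (Y k \<omega>)\<^sup>2)"
    using integrable_monomial[of "add_mset k (add_mset k e)"] e k
    by (simp add: mult_ac power2_eq_square)
  have 3: "(\<lambda>\<omega>. \<Sum>i=1..d. t i * Y i \<omega>) \<in> borel_measurable M"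
    by measurable
  show ?thesis
    using has_vector_derivative_integral_iexp[OF integrable_monomial[OF e] 1 2 Y_measurable[OF k] 3]
    by (simp only: char_monomial_def monomial_add_mset sum_fun_upd_add[OF k, of t]
        mult.commute[of "Y k _" "monomial e _"])
qed

text \<open>
  Gaussian integration by parts, with the exponential as a generating factor: differentiating
  the identity for \<open>e\<close> in the direction \<open>j\<close> gives the one for \<open>add_mset j e\<close>.
\<close>

lemma char_monomial_add_mset:
  assumes "set_mset e \<subseteq> {1..d}" "k \<in> {1..d}"
  shows "char_monomial (add_mset k e) t = \<i> * (\<Sum>i=1..d. S k i * t i) * char_monomial e t
           + (\<Sum>j\<in>#e. S k j * char_monomial (e - {#j#}) t)"
  using assms
proof (induction e arbitrary: t)
  case empty
  have "((\<lambda>h. char_monomial {#} (t(k := t k + h))) has_vector_derivative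
          - complex_of_real (\<Sum>i=1..d. S k i * t i) * char_monomial {#} t) (at 0)"
  proof -
    have shift: "quad_form d S (t(k := t k + h)) =
        quad_form d S t + 2 * h * (\<Sum>i=1..d. S k i * t i) + h\<^sup>2 * S k k" for h
      by (rule quad_form_fun_upd[OF S_sym empty(2)])
    have eq: "char_monomial {#} s = complex_of_real (exp (- quad_form d S s / 2))" for s
      unfolding char_Y[symmetric] by (simp add: char_monomial_def)
    have "((\<lambda>h. exp (- (quad_form d S t + 2 * h * (\<Sum>i=1..d. S k i * t i) + h\<^sup>2 * S k k) / 2))
        has_real_derivative - (\<Sum>i=1..d. S k i * t i) * exp (- quad_form d S t / 2)) (at 0)"
      by (auto intro!: derivative_eq_intros)
    note has_vector_derivative_of_real[OF this, where 'a = complex]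
    thus ?thesis
      unfolding eq shift by simp
  qed
  \<comment> \<open>The derivative is now known twice, from the explicit Gaussian formula and from
    differentiating under the integral. Equating the two and cancelling i settles the base
    case.\<close>
  from vector_derivative_unique_at[OF this char_monomial_derivative[OF empty]]
  have "\<i> * (\<i> * char_monomial {#k#} t) = \<i> * (- complex_of_real (\<Sum>i=1..d. S k i * t i) * char_monomial {#} t)"
    by (simp only:)
  thus ?case by simp
next
  case (add j e)
  let ?v = "\<Sum>i=1..d. S k i * t i"
  from add.prems have e: "set_mset e \<subseteq> {1..d}" and j: "j \<in> {1..d}" and k: "k \<in> {1..d}"
    by auto
  note IH = add.IH[OF e k]
  have lhs: "((\<lambda>h. char_monomial (add_mset k e) (t(j := t j + h)))
      has_vector_derivative \<i> * char_monomial (add_mset j (add_mset k e)) t) (at 0)"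
    using e j k by (intro char_monomial_derivative) auto
  \<comment> \<open>The range of summation \<open>f\<close> is decoupled from the \<open>e\<close>
    inside the summands, so that the induction over the range leaves the summands fixed.\<close>
  have sum_deriv: "((\<lambda>h. \<Sum>m\<in>#f. S k m * char_monomial (e - {#m#}) (t(j := t j + h)))
      has_vector_derivative (\<Sum>m\<in>#f. S k m * (\<i> * char_monomial (add_mset j (e - {#m#})) t))) (at 0)"
    for f
  proof (induction f)
    case (add m f)
    have "((\<lambda>h. S k m * char_monomial (e - {#m#}) (t(j := t j + h)))
      has_vector_derivative (S k m * (\<i> * char_monomial (add_mset j (e - {#m#})) t))) (at 0)"
      using e j by (intro has_vector_derivative_mult_right char_monomial_derivative)
        (auto dest: in_diffD)
    from has_vector_derivative_add[OF this add] show ?case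
      by (simp only: image_mset_add_mset sum_mset.add_mset)
  qed simp
  \<comment> \<open>Differentiating the linear factor in direction \<open>j\<close> produces
    \<open>S k j\<close>: this is the new summand, in which \<open>k\<close> is paired with the
    added index \<open>j\<close>.\<close>
  have "((\<lambda>h. complex_of_real (?v + S k j * h)) has_vector_derivative of_real (S k j)) (at 0)"
    by (intro has_vector_derivative_of_real) (auto intro!: derivative_eq_intros)
  hence "((\<lambda>h. \<i> * complex_of_real (?v + S k j * h) * char_monomial e (t(j := t j + h)))
     has_vector_derivative \<i> * (S k j * char_monomial e t) + \<i> * ?v * (\<i> * char_monomial (add_mset j e) t)) (at 0)"
    using char_monomial_derivative[OF e j, of t]
    by (auto intro!: derivative_eq_intros)
  hence rhs: "((\<lambda>h. char_monomial (add_mset k e) (t(j := t j + h))) has_vector_derivative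
      \<i> * (S k j * char_monomial e t) + \<i> * ?v * (\<i> * char_monomial (add_mset j e) t)
      + (\<Sum>m\<in>#e. S k m * (\<i> * char_monomial (add_mset j (e - {#m#})) t))) (at 0)"
    unfolding IH sum_scaled_fun_upd_add[OF j, of _ t]
    by (intro has_vector_derivative_add sum_deriv)
  \<comment> \<open>For \<open>m\<close> in \<open>e\<close>, adding \<open>j\<close> commutes with
    deleting \<open>m\<close>, also when \<open>m\<close> equals \<open>j\<close>.\<close>
  have "(\<Sum>m\<in>#e. S k m * (\<i> * char_monomial (add_mset j (e - {#m#})) t)) =
      \<i> * (\<Sum>m\<in>#e. S k m * char_monomial (add_mset j e - {#m#}) t)"
    unfolding sum_mset_distrib_left
    by (intro arg_cong[of _ _ sum_mset] image_mset_cong) (auto simp: mult_ac)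
  with vector_derivative_unique_at[OF lhs rhs]
  have "\<i> * char_monomial (add_mset k (add_mset j e)) t = \<i> * (S k j * char_monomial e t
     + \<i> * ?v * char_monomial (add_mset j e) t + (\<Sum>m\<in>#e. S k m * char_monomial (add_mset j e - {#m#}) t))"
    by (simp add: algebra_simps add_mset_commute)
  hence "char_monomial (add_mset k (add_mset j e)) t = S k j * char_monomial e t
     + \<i> * ?v * char_monomial (add_mset j e) t + (\<Sum>m\<in>#e. S k m * char_monomial (add_mset j e - {#m#}) t)"
    by (rule mult_left_cancel[THEN iffD1, OF complex_i_not_zero])
  moreover have "(\<Sum>m\<in>#add_mset j e. S k m * char_monomial (add_mset j e - {#m#}) t) =
      S k j * char_monomial e t + (\<Sum>m\<in>#e. S k m * char_monomial (add_mset j e - {#m#}) t)"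
    by simp
  ultimately show ?case
    by (simp only: add_ac)
qed

definition moment :: "nat multiset \<Rightarrow> real" where
  "moment e = (LINT \<omega>|M. monomial e \<omega>)"

lemma moment_empty [simp]: "moment {#} = 1"
  by (simp add: moment_def prob_space)

text \<open>At t = 0 the linear term of \<open>char_monomial_add_mset\<close> vanishes and only the
  pairings remain.\<close>

theorem wick_recursion:
  assumes "set_mset e \<subseteq> {1..d}" "k \<in> {1..d}"
  shows "moment (add_mset k e) = (\<Sum>j\<in>#e. S k j * moment (e - {#j#}))"
proof -
  have *: "char_monomial f (\<lambda>_. 0) = complex_of_real (moment f)" for f
    by (simp add: char_monomial_def moment_def)
  have "complex_of_real (moment (add_mset k e)) = (\<Sum>j\<in>#e. of_real (S k j * moment (e - {#j#})))"
    using char_monomial_add_mset[OF assms, of "\<lambda>_. 0"] by (simp add: *)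
  also have "\<dots> = of_real (\<Sum>j\<in>#e. S k j * moment (e - {#j#}))"
    by (simp add: of_real_sum_mset image_mset.compositionality o_def)
  finally show ?thesis
    by (simp only: of_real_eq_iff)
qed

end

section \<open>Moments of weakly correlated Gaussian vectors\<close>

locale weakly_correlated_gaussian_vector = gaussian_vector M d S Y
  for M :: "'w measure" and d S Y +
  fixes \<eta> :: real
  assumes eta: "0 \<le> \<eta>" "\<eta> \<le> 1"
    and S_bound: "\<And>i j. i \<in> {1..d} \<Longrightarrow> j \<in> {1..d} \<Longrightarrow> i \<noteq> j \<Longrightarrow> \<bar>S i j\<bar> \<le> \<eta>\<^sup>2"
begin

lemma eta_power_antimono: "m \<le> n \<Longrightarrow> \<eta> ^ n \<le> \<eta> ^ m"
  using eta by (intro power_decreasing)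

text \<open>The induction is on the degree and strong, since one application of Wick's recursion
  removes two indices. The factorial is a crude count of pairings: there are \<open>size f\<close>
  summands, each bounded with the factor (\<open>size f\<close> - 1)!.\<close>

lemma abs_moment_le:
  assumes "set_mset e \<subseteq> {1..d}"
  shows "\<bar>moment e\<bar> \<le> fact (size e) * \<eta> ^ card (odd_part e)"
  using assms
proof (induction "size e" arbitrary: e rule: less_induct)
  case less
  show ?case
  proof (cases e)
    case empty
    thus ?thesis by (simp add: odd_part_def)
  next
    case (add k f)
    from less.prems add have f: "set_mset f \<subseteq> {1..d}" and k: "k \<in> {1..d}"
      by auto
    have summand: "\<bar>S k j * moment (f - {#j#})\<bar> \<le> fact (size f - 1) * \<eta> ^ card (odd_part e)"
      if j: "j \<in># f" for j
    proof -
      define g where "g = f - {#j#}"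
      have fg: "f = add_mset j g"
        using j by (simp add: g_def)
      have IH: "\<bar>moment g\<bar> \<le> fact (size g) * \<eta> ^ card (odd_part g)"
        using less.hyps[of g] f add by (simp add: fg)
      show ?thesis
      proof (cases "j = k")
        case True
        \<comment> \<open>Deleting two equal indices changes no parity, and the diagonal covariance
          1 costs nothing.\<close>
        have "odd_part e = odd_part g"
          by (auto simp: odd_part_def add fg True)
        thus ?thesis
          using IH S_diag[OF k] True by (simp add: fg)
      next
        case False
        have "odd_part e \<subseteq> insert k (insert j (odd_part g))"
          by (auto simp: odd_part_def add fg split: if_splits)
        hence "card (odd_part e) \<le> card (insert k (insert j (odd_part g)))"
          by (intro card_mono) auto
        also have "\<dots> \<le> card (odd_part g) + 2"
          by (simp add: card_insert_if)
        finally have card: "card (odd_part e) \<le> 2 + card (odd_part g)"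
          by simp
        have "\<bar>S k j * moment g\<bar> \<le> \<eta>\<^sup>2 * (fact (size g) * \<eta> ^ card (odd_part g))"
          unfolding abs_mult using j f k False eta by (intro mult_mono S_bound IH) auto
        also have "\<dots> = fact (size g) * \<eta> ^ (2 + card (odd_part g))"
          by (simp add: power_add power2_eq_square)
        also have "\<dots> \<le> fact (size g) * \<eta> ^ card (odd_part e)"
          by (intro mult_left_mono eta_power_antimono card) auto
        finally show ?thesis
          by (simp add: fg)
      qed
    qed
    have "\<bar>moment e\<bar> \<le> real (size f) * (fact (size f - 1) * \<eta> ^ card (odd_part e))"
      unfolding add wick_recursion[OF f k] unfolding add[symmetric] by (intro abs_sum_mset_le summand)
    \<comment> \<open>When \<open>f\<close> is empty, \<open>size f - 1\<close> is truncated to 0,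
      but the factor \<open>size f\<close> is then 0 as well.\<close>
    also have "\<dots> \<le> fact (size f) * \<eta> ^ card (odd_part e)"
      by (cases "size f") (auto simp: eta)
    also have "\<dots> \<le> fact (size e) * \<eta> ^ card (odd_part e)"
      using eta by (intro mult_right_mono fact_mono) (auto simp: add)
    finally show ?thesis .
  qed
qed

text \<open>Expand one of the two new factors by Wick's recursion. Paired with its twin it returns
  exactly \<open>moment e\<close>. Each of the other \<open>size e\<close> pairings matches
  \<open>k\<close> with some \<open>j\<close> in \<open>e\<close>, at cost \<eta>^2, and leaves a
  monomial in which precisely \<open>j\<close> and \<open>k\<close> are odd, worth another
  \<eta>^2.\<close>

lemma moment_add_square:
  assumes e: "set_mset e \<subseteq> {1..d}" and k: "k \<in> {1..d}" "k \<notin># e" and even: "odd_part e = {}"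
  shows "\<bar>moment (add_mset k (add_mset k e)) - moment e\<bar> \<le> real (size e) * fact (size e) * \<eta> ^ 4"
proof -
  have summand: "\<bar>S k j * moment (add_mset k e - {#j#})\<bar> \<le> fact (size e) * \<eta> ^ 4" if j: "j \<in># e" for j
  proof -
    define g where "g = e - {#j#}"
    have eg: "e = add_mset j g"
      using j by (simp add: g_def)
    have neq: "j \<noteq> k"
      using j k by auto
    \<comment> \<open>All multiplicities in \<open>e\<close> are even, so deleting one
      \<open>j\<close> makes \<open>j\<close> odd, while \<open>k\<close>, absent from
      \<open>e\<close>, now occurs once.\<close>
    have "odd (count (add_mset k g) i) \<longleftrightarrow> i \<in> {j, k}" for i
    proof -
      have "even (count e i)" "count e k = 0"
        using even k by (auto simp: odd_part_def count_eq_zero_iff)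
      thus ?thesis
        using neq by (cases "i = j"; cases "i = k") (auto simp: eg)
    qed
    hence "odd_part (add_mset k g) = {j, k}"
      unfolding odd_part_def by auto
    hence "\<bar>moment (add_mset k g)\<bar> \<le> fact (size e) * \<eta> ^ 2"
      using abs_moment_le[of "add_mset k g"] e k neq by (simp add: eg numeral_2_eq_2)
    hence "\<bar>S k j\<bar> * \<bar>moment (add_mset k g)\<bar> \<le> \<eta>\<^sup>2 * (fact (size e) * \<eta>\<^sup>2)"
      using j e k neq eta by (intro mult_mono S_bound) auto
    thus ?thesis
      using neq by (simp add: abs_mult eg add_mset_commute[of k j] power2_eq_square power4_eq_xxxx mult_ac)
  qed
  have "moment (add_mset k (add_mset k e)) - moment e = (\<Sum>j\<in>#e. S k j * moment (add_mset k e - {#j#}))"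
    using e k by (simp add: wick_recursion[of "add_mset k e"] S_diag)
  thus ?thesis
    using abs_sum_mset_le[OF summand] by (simp add: mult.assoc)
qed

text \<open>Telescoping: the squares are added one at a time, and every intermediate monomial stays
  even and free of the next index. The factorial absorbs m * m! <= (m+1)!, where m is the degree
  before a square is added. The base monomial \<open>e\<close> is left general to serve both AAU2
  (empty) and AAU3 (a fourth power).\<close>

lemma moment_add_squares:
  assumes e: "set_mset e \<subseteq> {1..d}" and even: "odd_part e = {}"
    and "finite A" "A \<subseteq> {1..d}" "A \<inter> set_mset e = {}"
  shows "\<bar>moment ((\<Sum>k\<in>A. replicate_mset 2 k) + e) - moment e\<bar>
    \<le> real (card A) * fact (2 * card A + size e + 1) * \<eta> ^ 4"
  using \<open>finite A\<close> assms(4,5)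
proof (induction A rule: finite_induct)
  case (insert k A)
  define f where "f = (\<Sum>k\<in>A. replicate_mset 2 k) + e"
  have size_f: "size f = 2 * card A + size e"
    by (simp add: f_def size_sum)
  have count_f: "count f i = (if i \<in> A then 2 else 0) + count e i" for i
    using insert.hyps by (simp add: f_def count_sum if_distrib cong: if_cong)
  have set_f: "set_mset f = A \<union> set_mset e"
    unfolding set_mset_def by (auto simp: count_f split: if_splits)
  have odd_f: "odd_part f = {}"
    using even by (auto simp: odd_part_def count_f)
  have "\<bar>moment (add_mset k (add_mset k f)) - moment f\<bar> \<le> real (size f) * fact (size f) * \<eta> ^ 4"
    using insert e odd_f by (intro moment_add_square) (auto simp: set_f)
  also have "\<dots> \<le> fact (size f + 1) * \<eta> ^ 4"
    using eta by (intro mult_right_mono) (auto simp: algebra_simps)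
  finally have "\<bar>moment (add_mset k (add_mset k f)) - moment e\<bar> \<le>
      fact (size f + 1) * \<eta> ^ 4 + real (card A) * fact (size f + 1) * \<eta> ^ 4"
    using insert.IH insert.prems unfolding f_def[symmetric] size_f by auto
  also have "\<dots> = real (card (insert k A)) * fact (size f + 1) * \<eta> ^ 4"
    using insert.hyps by (simp add: algebra_simps)
  also have "\<dots> \<le> real (card (insert k A)) * fact (2 * card (insert k A) + size e + 1) * \<eta> ^ 4"
  proof (intro mult_right_mono mult_left_mono)
    show "(fact (size f + 1) :: real) \<le> fact (2 * card (insert k A) + size e + 1)"
      using insert.hyps by (intro fact_mono) (simp add: size_f)
  qed (use eta in auto)
  also have "add_mset k (add_mset k f) = (\<Sum>k\<in>insert k A. replicate_mset 2 k) + e"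
    using insert.hyps by (simp add: f_def numeral_2_eq_2)
  finally show ?case .
qed simp

end

section \<open>Gaussian triangular schemes\<close>

text \<open>By symmetry \<phi> depends only on the sorted pair, and on sorted pairs it is
  injective.\<close>

lemma triangular_index_unique:
  assumes bij: "bij_betw \<phi> {(i, j) \<in> square n. i \<le> j} B"
    and sym: "\<forall>(i, j)\<in>square n. j < i \<longrightarrow> \<phi> (i, j) = \<phi> (j, i)"
    and "(i, j) \<in> square n" "(i', j') \<in> square n" "\<phi> (i, j) = \<phi> (i', j')"
  shows "{i, j} = {i', j'}"
proof -
  have *: "\<phi> (i, j) = \<phi> (min i j, max i j)" "(min i j, max i j) \<in> {(i, j) \<in> square n. i \<le> j}"
    if ij: "(i, j) \<in> square n" for i j
  proof -
    show "\<phi> (i, j) = \<phi> (min i j, max i j)"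
    proof (cases "i \<le> j")
      case False
      thus ?thesis
        using bspec[OF sym ij] by (simp add: min_def max_def)
    qed (simp add: min_def max_def)
    show "(min i j, max i j) \<in> {(i, j) \<in> square n. i \<le> j}"
      using ij by (simp add: square_def min_def max_def)
  qed
  have "(min i j, max i j) = (min i' j', max i' j')"
  proof (rule inj_onD[OF bij_betw_imp_inj_on[OF bij]])
    show "\<phi> (min i j, max i j) = \<phi> (min i' j', max i' j')"
      using *(1)[OF assms(3)] *(1)[OF assms(4)] assms(5) by simp
  qed (intro *(2) assms(3,4))+
  thus ?thesis
    by (auto simp: min_def max_def split: if_splits)
qed

text \<open>The bridge to the moment estimates: fundamental difference of the pairs becomes
  injectivity of \<open>j\<close>, so products of entries become monomials with controlled
  multiplicities.\<close>

lemma gaussian_scheme_vector: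
  assumes M: "prob_space M" and \<alpha>: "\<alpha> > 0" and S: "S \<in> CovMat \<alpha>"
    and a: "gaussian_triangular_scheme M S a"
    and N: "1 \<le> N" "N \<le> n" and pq: "fund_diff_pairs N l p q"
  obtains Y j where
    "weakly_correlated_gaussian_vector M (triangle n) (S (triangle n)) Y (real (triangle n) powr (-\<alpha>/2))"
    "inj_on j {1..l}" "j ` {1..l} \<subseteq> {1..triangle n}"
    "\<And>i \<omega>. i \<in> {1..l} \<Longrightarrow> \<omega> \<in> space M \<Longrightarrow> a n (p i) (q i) \<omega> = Y (j i) \<omega>"
proof -
  interpret prob_space M by (rule M)
  have n: "n \<ge> 1" using N by simp
  hence t: "triangle n \<ge> 1"
    using mult_le_mono[of 1 n 2 "n + 1"]
    unfolding triangle_def One_nat_def Suc_le_eq div_greater_zero_iff by simp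
  from mp[OF spec[OF a[unfolded gaussian_triangular_scheme_def], of n] n] obtain Y \<phi> where Y: "centered_gaussian M (triangle n) (S (triangle n)) Y"
    and \<phi>: "\<phi> \<in> square n \<rightarrow> {1..triangle n}" "bij_betw \<phi> {(i, j) \<in> square n. i \<le> j} {1..triangle n}"
      "\<forall>(i, j)\<in>square n. j < i \<longrightarrow> \<phi> (i, j) = \<phi> (j, i)"
      "\<forall>(i, j)\<in>square n. \<forall>\<omega>\<in>space M. a n i j \<omega> = Y (\<phi> (i, j)) \<omega>"
    by (elim exE conjE)
  from S have "\<forall>n\<ge>1. sym_pos_def n (S n) \<and> (\<forall>i\<in>{1..n}. S n i i = 1) \<and>
     (\<forall>i\<in>{1..n}. \<forall>j\<in>{1..n}. i \<noteq> j \<longrightarrow> \<bar>S n i j\<bar> \<le> real n powr (-\<alpha>))"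
    by (simp only: CovMat_def mem_Collect_eq)
  note \<Sigma> = mp[OF spec[OF this, of "triangle n"] t]
  define j where "j i = \<phi> (p i, q i)" for i
  have sq: "(p i, q i) \<in> square n" if "i \<in> {1..l}" for i
    using that pq N by (auto simp: fund_diff_pairs_def square_def dest: bspec[of _ _ i])
  show ?thesis
  proof
    show "weakly_correlated_gaussian_vector M (triangle n) (S (triangle n)) Y
        (real (triangle n) powr (-\<alpha>/2))"
    proof
      show "real (triangle n) powr (-\<alpha>/2) \<le> 1"
        using t \<alpha> powr_mono[of "-\<alpha>/2" 0 "triangle n"] by simp
      show "\<bar>S (triangle n) i k\<bar> \<le> (real (triangle n) powr (-\<alpha>/2))\<^sup>2"
        if "i \<in> {1..triangle n}" "k \<in> {1..triangle n}" "i \<noteq> k" for i k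
        using \<Sigma> that by (simp add: power2_eq_square flip: powr_add)
    qed (use \<Sigma> Y in \<open>simp_all add: sym_pos_def_def\<close>)
    show "inj_on j {1..l}"
    proof (rule inj_onI)
      fix i k assume ik: "i \<in> {1..l}" "k \<in> {1..l}" "j i = j k"
      hence "{p i, q i} = {p k, q k}"
        unfolding j_def by (intro triangular_index_unique[OF \<phi>(2,3)] sq) auto
      thus "i = k"
        using pq ik unfolding fund_diff_pairs_def by blast
    qed
    show "j ` {1..l} \<subseteq> {1..triangle n}"
      using sq by (auto simp only: j_def intro!: funcset_mem[OF \<phi>(1)])
    show "a n (p i) (q i) \<omega> = Y (j i) \<omega>" if "i \<in> {1..l}" "\<omega> \<in> space M" for i \<omega>
      using bspec[OF \<phi>(4) sq[OF that(1)]] that(2) by (simp add: j_def)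
  qed
qed

text \<open>Raise \<Delta>_n >= n^2/2 to the negative power -\<alpha>/2. This is the origin of the
  constant \<open>K\<close> below.\<close>

lemma triangle_powr_le:
  assumes "\<alpha> > 0" "n \<ge> 1"
  shows "real (triangle n) powr (-\<alpha>/2) \<le> 2 powr (\<alpha>/2) * real n powr (-\<alpha>)"
proof -
  have 1: "(real n powr 2) powr (\<alpha>/2) = real n powr \<alpha>"
    unfolding powr_powr by simp
  have "real (triangle n) = real n * (real n + 1) / 2"
    by (simp add: triangle_def real_of_nat_div algebra_simps)
  hence "real n powr 2 / 2 \<le> real (triangle n)"
    using assms by (simp add: power2_eq_square algebra_simps)
  hence "real (triangle n) powr (-\<alpha>/2) \<le> (real n powr 2 / 2) powr (-\<alpha>/2)"
    using assms by (intro powr_mono2') auto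
  also have "\<dots> = 2 powr (\<alpha>/2) * real n powr (-\<alpha>)"
    using assms 1 by (simp add: powr_divide powr_minus field_simps del: powr_numeral)
  finally show ?thesis .
qed

locale gaussian_scheme = prob_space M
  for M :: "'w measure" +
  fixes \<alpha> :: real and S :: "nat \<Rightarrow> nat \<Rightarrow> nat \<Rightarrow> real" and a :: "nat \<Rightarrow> nat \<Rightarrow> nat \<Rightarrow> 'w \<Rightarrow> real"
  assumes alpha: "\<alpha> > 0" and S: "S \<in> CovMat \<alpha>" and scheme: "gaussian_triangular_scheme M S a"
begin

definition \<eta> :: "nat \<Rightarrow> real" where "\<eta> n = real (triangle n) powr (-\<alpha>/2)"

definition K :: real where "K = 2 powr (\<alpha>/2)"

lemma K_ge_1: "K \<ge> 1"
  using alpha by (simp add: K_def ge_one_powr_ge_zero)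

lemma eta_power_le:
  assumes "n \<ge> 1"
  shows "\<eta> n ^ k \<le> K ^ k * real n powr (-\<alpha> * real k)"
proof -
  have "\<eta> n ^ k \<le> (K * real n powr (-\<alpha>)) ^ k"
    unfolding \<eta>_def K_def using alpha assms by (intro power_mono triangle_powr_le) auto
  thus ?thesis
    using assms by (simp add: power_mult_distrib powr_power mult.commute)
qed

lemma fund_diff_vector:
  assumes "1 \<le> N" "N \<le> n" "fund_diff_pairs N l p q"
  obtains Y j where
    "weakly_correlated_gaussian_vector M (triangle n) (S (triangle n)) Y (\<eta> n)"
    "inj_on j {1..l}" "j ` {1..l} \<subseteq> {1..triangle n}"
    "\<And>i \<omega>. i \<in> {1..l} \<Longrightarrow> \<omega> \<in> space M \<Longrightarrow> a n (p i) (q i) \<omega> = Y (j i) \<omega>"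
  using gaussian_scheme_vector[OF prob_space_axioms alpha S scheme assms] unfolding \<eta>_def by blast

text \<open>A single entry is a family of one pair, so measurability and existence of moments also
  come from \<open>fund_diff_vector\<close>.\<close>

lemma fund_diff_pairs_single: "(p, q) \<in> square n \<Longrightarrow> fund_diff_pairs n 1 (\<lambda>_. p) (\<lambda>_. q)"
  by (simp add: fund_diff_pairs_def)

lemma triangular_scheme: "triangular_scheme M a"
  unfolding triangular_scheme_def
proof (intro allI impI ballI, clarify, intro conjI ballI)
  fix n p q assume n: "1 \<le> n" and pq: "(p, q) \<in> square n"
  from fund_diff_vector[OF n order_refl fund_diff_pairs_single[OF pq]] obtain Y j where
    Y: "weakly_correlated_gaussian_vector M (triangle n) (S (triangle n)) Y (\<eta> n)"
    and j: "j ` {1..1} \<subseteq> {1..triangle n}"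
    and eq: "\<And>i \<omega>. i \<in> {1..1::nat} \<Longrightarrow> \<omega> \<in> space M \<Longrightarrow> a n p q \<omega> = Y (j i) \<omega>"
    by metis
  interpret Y: weakly_correlated_gaussian_vector M "triangle n" "S (triangle n)" Y "\<eta> n"
    by (rule Y)
  have "Y (j 1) \<in> borel_measurable M"
    using j by (intro Y.Y_measurable) auto
  thus "a n p q \<in> borel_measurable M"
    by (subst measurable_cong[OF eq[of 1]]) auto
  fix \<omega> assume \<omega>: "\<omega> \<in> space M"
  \<comment> \<open>Symmetry of the matrix rests on that of \<phi>, which
    \<open>fund_diff_vector\<close> hides, so the scheme is unfolded again.\<close>
  from mp[OF spec[OF scheme[unfolded gaussian_triangular_scheme_def], of n] n] obtain Z \<phi> where
    "centered_gaussian M (triangle n) (S (triangle n)) Z"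
    "\<phi> \<in> square n \<rightarrow> {1..triangle n}"
    "bij_betw \<phi> {(i, j) \<in> square n. i \<le> j} {1..triangle n}"
    and \<phi>: "\<forall>(i, j)\<in>square n. j < i \<longrightarrow> \<phi> (i, j) = \<phi> (j, i)"
      "\<forall>(i, j)\<in>square n. \<forall>\<omega>\<in>space M. a n i j \<omega> = Z (\<phi> (i, j)) \<omega>"
    by (elim exE conjE)
  have qp: "(q, p) \<in> square n"
    using pq by (simp add: square_def)
  have "\<phi> (p, q) = \<phi> (q, p)"
    using bspec[OF \<phi>(1) pq] bspec[OF \<phi>(1) qp] by (cases p q rule: linorder_cases) auto
  thus "a n p q \<omega> = a n q p \<omega>"
    using bspec[OF \<phi>(2) pq] bspec[OF \<phi>(2) qp] \<omega> by simp
qed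

lemma moments_exist: "moments_exist M a"
  unfolding moments_exist_def
proof (intro allI impI ballI, clarify)
  fix n p q and k :: nat
  assume n: "1 \<le> n" and pq: "(p, q) \<in> square n"
  from fund_diff_vector[OF n order_refl fund_diff_pairs_single[OF pq]] obtain Y j where
    Y: "weakly_correlated_gaussian_vector M (triangle n) (S (triangle n)) Y (\<eta> n)"
    and j: "j ` {1..1} \<subseteq> {1..triangle n}"
    and eq: "\<And>i \<omega>. i \<in> {1..1::nat} \<Longrightarrow> \<omega> \<in> space M \<Longrightarrow> a n p q \<omega> = Y (j i) \<omega>"
    by metis
  interpret Y: weakly_correlated_gaussian_vector M "triangle n" "S (triangle n)" Y "\<eta> n"
    by (rule Y)
  have "integrable M (\<lambda>\<omega>. Y (j 1) \<omega> ^ k)"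
    using j by (intro Y.integrable_Y_power) auto
  thus "integrable M (\<lambda>\<omega>. a n p q \<omega> ^ k)"
    by (subst Bochner_Integration.integrable_cong[OF refl, of _ _ "\<lambda>\<omega>. Y (j 1) \<omega> ^ k"]) (auto simp: eq[of 1])
qed

text \<open>Exponents equal to 1 are odd, so the parity bound is at least as strong as the required
  one. Since K >= 1 and there are at most k exponents equal to 1, the power of K that arises is
  replaced by K^k; the constant then depends on the total degree alone.\<close>

lemma AAU1: "AAU1 M \<alpha> a (\<lambda>k. fact k * K ^ k)"
  unfolding AAU1_def
proof (intro allI impI)
  fix N l n :: nat and p q \<delta> :: "nat \<Rightarrow> nat"
  assume N: "1 \<le> N" "N \<le> n" and pq: "fund_diff_pairs N l p q" and \<delta>: "\<forall>i\<in>{1..l}. 1 \<le> \<delta> i"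
  from fund_diff_vector[OF N pq] obtain Y j where
    Y: "weakly_correlated_gaussian_vector M (triangle n) (S (triangle n)) Y (\<eta> n)"
    and j: "inj_on j {1..l}" "j ` {1..l} \<subseteq> {1..triangle n}"
    and eq: "\<And>i \<omega>. i \<in> {1..l} \<Longrightarrow> \<omega> \<in> space M \<Longrightarrow> a n (p i) (q i) \<omega> = Y (j i) \<omega>"
    by metis
  interpret Y: weakly_correlated_gaussian_vector M "triangle n" "S (triangle n)" Y "\<eta> n"
    by (rule Y)
  let ?I = "{i\<in>{1..l}. \<delta> i = 1}" and ?k = "\<Sum>i=1..l. \<delta> i"
  define e where "e = (\<Sum>i=1..l. replicate_mset (\<delta> i) (j i))"
  \<comment> \<open>Injectivity of \<open>j\<close> keeps the exponents of different entries from
    adding up.\<close>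
  have count: "count e (j i) = \<delta> i" if "i \<in> {1..l}" for i
  proof -
    have "count e (j i) = (\<Sum>i'=1..l. if i' = i then \<delta> i' else 0)"
      unfolding e_def count_sum using that
      by (intro sum.cong) (auto dest: inj_onD[OF j(1)])
    thus ?thesis using that by simp
  qed
  have "set_mset e \<subseteq> j ` {1..l}"
    unfolding e_def set_mset_sum[OF finite_atLeastAtMost]
    by (intro UN_least) (simp add: set_mset_replicate_mset_subset)
  hence e: "set_mset e \<subseteq> {1..triangle n}"
    using j(2) by (rule subset_trans)
  have size: "size e = ?k"
    by (simp add: e_def size_sum)
  have "card ?I = card (j ` ?I)"
    by (intro card_image[symmetric] inj_on_subset[OF j(1)]) auto
  also have "\<dots> \<le> card (odd_part e)"
  proof (intro card_mono finite_odd_part subsetI)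
    fix x assume "x \<in> j ` ?I"
    then obtain i where "i \<in> {1..l}" "\<delta> i = 1" "x = j i"
      by blast
    thus "x \<in> odd_part e"
      using count[of i] by (simp add: odd_part_def)
  qed
  finally have card_odd: "card ?I \<le> card (odd_part e)" .
  have "card ?I \<le> card {1..l}"
    by (intro card_mono) auto
  also have "\<dots> \<le> ?k"
    using sum_mono[of "{1..l}" "\<lambda>_. 1" \<delta>] \<delta> by simp
  finally have card_le: "card ?I \<le> ?k" .
  have "(LINT \<omega>|M. (\<Prod>i=1..l. a n (p i) (q i) \<omega> ^ \<delta> i)) = Y.moment e"
    unfolding Y.moment_def e_def
    by (intro Bochner_Integration.integral_cong refl)
      (simp add: Y.monomial_sum Y.monomial_replicate eq)
  also have "\<bar>\<dots>\<bar> \<le> fact ?k * \<eta> n ^ card (odd_part e)"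
    using Y.abs_moment_le[OF e] by (simp add: size)
  also have "\<dots> \<le> fact ?k * \<eta> n ^ card ?I"
    by (intro mult_left_mono Y.eta_power_antimono card_odd) auto
  also have "\<dots> \<le> fact ?k * (K ^ card ?I * real n powr (-\<alpha> * real (card ?I)))"
    using N by (intro mult_left_mono eta_power_le) auto
  also have "\<dots> \<le> fact ?k * (K ^ ?k * real n powr (-\<alpha> * real (card ?I)))"
    using K_ge_1 card_le by (intro mult_left_mono mult_right_mono power_increasing) auto
  finally show "\<bar>LINT \<omega>|M. (\<Prod>i=1..l. a n (p i) (q i) \<omega> ^ \<delta> i)\<bar>
      \<le> fact ?k * K ^ ?k * real n powr (-\<alpha> * real (card ?I))"
    by (simp only: mult.assoc)
qed

text \<open>The \<open>l\<close> squares are added to the empty monomial, whose moment is the 1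
  being subtracted.\<close>

lemma AAU2: "AAU2 M a (\<lambda>l n. real l * fact (2 * l + 1) * K ^ 4 * real n powr (-\<alpha> * 4))"
  unfolding AAU2_def
proof (intro allI impI)
  fix N l n :: nat and p q
  assume N: "1 \<le> N" "N \<le> n" and pq: "fund_diff_pairs N l p q"
  from fund_diff_vector[OF N pq] obtain Y j where
    Y: "weakly_correlated_gaussian_vector M (triangle n) (S (triangle n)) Y (\<eta> n)"
    and j: "inj_on j {1..l}" "j ` {1..l} \<subseteq> {1..triangle n}"
    and eq: "\<And>i \<omega>. i \<in> {1..l} \<Longrightarrow> \<omega> \<in> space M \<Longrightarrow> a n (p i) (q i) \<omega> = Y (j i) \<omega>"
    by metis
  interpret Y: weakly_correlated_gaussian_vector M "triangle n" "S (triangle n)" Y "\<eta> n"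
    by (rule Y)
  let ?A = "j ` {1..l}"
  have card: "card ?A = l"
    using card_image[OF j(1)] by simp
  have "(LINT \<omega>|M. (\<Prod>i=1..l. (a n (p i) (q i) \<omega>)\<^sup>2)) = Y.moment ((\<Sum>k\<in>?A. replicate_mset 2 k) + {#})"
    unfolding Y.moment_def
    by (intro Bochner_Integration.integral_cong refl)
      (simp add: Y.monomial_sum Y.monomial_replicate eq prod.reindex[OF j(1)[unfolded One_nat_def]])
  moreover have "\<bar>Y.moment ((\<Sum>k\<in>?A. replicate_mset 2 k) + {#}) - Y.moment {#}\<bar> \<le>
      real (card ?A) * fact (2 * card ?A + size ({#} :: nat multiset) + 1) * \<eta> n ^ 4"
    using j(2) by (intro Y.moment_add_squares) (auto simp: odd_part_def)
  ultimately have "\<bar>(LINT \<omega>|M. (\<Prod>i=1..l. (a n (p i) (q i) \<omega>)\<^sup>2)) - 1\<bar> \<le> real l * fact (2 * l + 1) * \<eta> n ^ 4"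
    unfolding card by (simp del: One_nat_def fact_Suc)
  also have "\<dots> \<le> real l * fact (2 * l + 1) * (K ^ 4 * real n powr (-\<alpha> * 4))"
    using N eta_power_le[of n 4] by (intro mult_left_mono) auto
  finally show "\<bar>(LINT \<omega>|M. (\<Prod>i=1..l. (a n (p i) (q i) \<omega>)\<^sup>2)) - 1\<bar>
      \<le> real l * fact (2 * l + 1) * K ^ 4 * real n powr (-\<alpha> * 4)"
    by (simp only: mult.assoc)
qed

text \<open>After multiplying out, this is the change of the moment of a fourth power when l - 1
  squares of other coordinates are added. The 5 is the degree 4 of the base monomial plus the 1 in
  \<open>moment_add_squares\<close>.\<close>

lemma AAU3: "AAU3 M a (\<lambda>l n. real (l - 1) * fact (2 * (l - 1) + 5) * K ^ 4 * real n powr (-\<alpha> * 4))"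
  unfolding AAU3_def
proof (intro allI impI)
  fix N l n :: nat and p q
  assume N: "1 \<le> N" "N \<le> n" and l: "1 \<le> l" and pq: "fund_diff_pairs N l p q"
  from fund_diff_vector[OF N(1,2) pq] obtain Y j where
    Y: "weakly_correlated_gaussian_vector M (triangle n) (S (triangle n)) Y (\<eta> n)"
    and j: "inj_on j {1..l}" "j ` {1..l} \<subseteq> {1..triangle n}"
    and eq: "\<And>i \<omega>. i \<in> {1..l} \<Longrightarrow> \<omega> \<in> space M \<Longrightarrow> a n (p i) (q i) \<omega> = Y (j i) \<omega>"
    by metis
  interpret Y: weakly_correlated_gaussian_vector M "triangle n" "S (triangle n)" Y "\<eta> n"
    by (rule Y)
  let ?A = "j ` {2..l}" and ?e = "replicate_mset 4 (j 1)"
  let ?f = "(\<Sum>k\<in>?A. replicate_mset 2 k) + ?e"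
  have inj: "inj_on j {2..l}"
    by (rule inj_on_subset[OF j(1)]) auto
  have card: "card ?A = l - 1"
    using card_image[OF inj] by simp
  have A: "?A \<subseteq> {1..triangle n}" "?A \<inter> set_mset ?e = {}"
    using j l by (auto dest: inj_onD[OF j(1)])
  have "j 1 \<in> {1..triangle n}"
    using l by (intro subsetD[OF j(2)] imageI) simp
  hence e: "set_mset ?e \<subseteq> {1..triangle n}" "odd_part ?e = {}"
    by (auto simp: odd_part_def)
  have f: "set_mset ?f \<subseteq> {1..triangle n}"
    using A e by (auto simp: set_mset_sum split: if_splits)
  have "(LINT \<omega>|M. a n (p 1) (q 1) \<omega> ^ 4 * ((\<Prod>i=2..l. (a n (p i) (q i) \<omega>)\<^sup>2) - 1)) =
      (LINT \<omega>|M. Y.monomial ?f \<omega> - Y.monomial ?e \<omega>)"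
    using l by (intro Bochner_Integration.integral_cong refl)
      (simp add: Y.monomial_plus Y.monomial_sum Y.monomial_replicate eq prod.reindex[OF inj] algebra_simps)
  also have "\<dots> = Y.moment ?f - Y.moment ?e"
    unfolding Y.moment_def
    by (intro Bochner_Integration.integral_diff Y.integrable_monomial f e)
  also have "\<bar>\<dots>\<bar> \<le> real (l - 1) * fact (2 * (l - 1) + 5) * \<eta> n ^ 4"
    using Y.moment_add_squares[OF e _ A] unfolding card by (simp add: add_ac)
  also have "\<dots> \<le> real (l - 1) * fact (2 * (l - 1) + 5) * (K ^ 4 * real n powr (-\<alpha> * 4))"
    using N eta_power_le[of n 4] by (intro mult_left_mono) auto
  finally show "\<bar>LINT \<omega>|M. a n (p 1) (q 1) \<omega> ^ 4 * ((\<Prod>i=2..l. (a n (p i) (q i) \<omega>)\<^sup>2) - 1)\<bar>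
      \<le> real (l - 1) * fact (2 * (l - 1) + 5) * K ^ 4 * real n powr (-\<alpha> * 4)"
    by (simp only: mult.assoc)
qed

theorem strongly_almost_uncorrelated_summable:
  "\<exists>C C' D. strongly_almost_uncorrelated_with M \<alpha> a C C' D \<and>
    (\<alpha> > 1/4 \<longrightarrow> (\<forall>l. summable (C' l) \<and> summable (D l)))"
proof (intro exI conjI impI)
  have lim: "(\<lambda>n. c * real n powr (-\<alpha> * 4)) \<longlonglongrightarrow> 0" for c
    using alpha by real_asymp
  show "strongly_almost_uncorrelated_with M \<alpha> a (\<lambda>k. fact k * K ^ k)
      (\<lambda>l n. real l * fact (2 * l + 1) * K ^ 4 * real n powr (-\<alpha> * 4))
      (\<lambda>l n. real (l - 1) * fact (2 * (l - 1) + 5) * K ^ 4 * real n powr (-\<alpha> * 4))"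
    unfolding strongly_almost_uncorrelated_with_def almost_uncorrelated_with_def
    by (intro conjI allI impI triangular_scheme moments_exist AAU1 AAU2 AAU3 lim)
  assume "\<alpha> > 1/4"
  \<comment> \<open>The threshold 1/4 is exactly the condition 4\<alpha> > 1 for this
    series.\<close>
  hence "summable (\<lambda>n. real n powr (-\<alpha> * 4))"
    by (simp add: summable_real_powr_iff)
  thus "\<forall>l. summable (\<lambda>n. real l * fact (2 * l + 1) * K ^ 4 * real n powr (-\<alpha> * 4)) \<and>
      summable (\<lambda>n. real (l - 1) * fact (2 * (l - 1) + 5) * K ^ 4 * real n powr (-\<alpha> * 4))"
    by (intro allI conjI summable_mult)
qed

end

section \<open>Tightness\<close>

definition two_correlated :: "real \<Rightarrow> nat \<Rightarrow> nat \<Rightarrow> real" where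
  "two_correlated \<rho> i j = (if i = j then 1 else if {i, j} = {1, 2} then \<rho> else 0)"

lemma quad_form_two_correlated:
  "quad_form d (two_correlated \<rho>) t = (\<Sum>i=1..d. (t i)\<^sup>2) + (if 2 \<le> d then 2 * \<rho> * t 1 * t 2 else 0)"
proof -
  \<comment> \<open>The diagonal and the cells (1,2) and (2,1) are written as indicators. If d < 2,
    the last two contribute nothing, as the index 2 is never reached.\<close>
  have "t i * two_correlated \<rho> i j * t j = (if j = i then (t i)\<^sup>2 else 0)
      + (if j = 2 then (if i = 1 then \<rho> * t 1 * t 2 else 0) else 0)
      + (if j = 1 then (if i = 2 then \<rho> * t 1 * t 2 else 0) else 0)" for i j
    by (auto simp: two_correlated_def power2_eq_square doubleton_eq_iff)
  thus ?thesis
    by (auto simp: quad_form_def sum.distrib)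
qed

text \<open>The cross term 2\<rho> t_1 t_2 is at least -\<rho>(t_1^2 + t_2^2), which cannot cancel
  the sum of squares when \<rho> < 1. The guard \<open>2 \<le> d\<close> admits dimension 1, where
  \<rho> = 1^(-\<alpha>) = 1.\<close>

lemma sym_pos_def_two_correlated:
  assumes "0 \<le> \<rho>" "2 \<le> d \<Longrightarrow> \<rho> < 1"
  shows "sym_pos_def d (two_correlated \<rho>)"
  unfolding sym_pos_def_def
proof (intro conjI ballI allI impI)
  fix t :: "nat \<Rightarrow> real" assume "\<exists>i\<in>{1..d}. t i \<noteq> 0"
  then obtain i where i: "i \<in> {1..d}" "t i \<noteq> 0"
    by blast
  hence pos: "(\<Sum>i=1..d. (t i)\<^sup>2) > 0"
    by (intro sum_pos2[of _ i]) auto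
  show "quad_form d (two_correlated \<rho>) t > 0"
  proof (cases "2 \<le> d")
    case True
    have "(\<Sum>i\<in>{1,2}. (t i)\<^sup>2) \<le> (\<Sum>i=1..d. (t i)\<^sup>2)"
      using True by (intro sum_mono2) auto
    hence "\<rho> * ((t 1)\<^sup>2 + (t 2)\<^sup>2) \<le> \<rho> * (\<Sum>i=1..d. (t i)\<^sup>2)"
      using assms by (intro mult_left_mono) auto
    moreover have "0 \<le> \<rho> * (t 1 + t 2)\<^sup>2"
      using assms by simp
    moreover have "\<rho> * (\<Sum>i=1..d. (t i)\<^sup>2) < (\<Sum>i=1..d. (t i)\<^sup>2)"
      using assms(2)[OF True] pos by simp
    ultimately show ?thesis
      using True by (simp add: quad_form_two_correlated power2_sum algebra_simps)
  qed (use pos in \<open>simp add: quad_form_two_correlated\<close>)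
qed (auto simp: two_correlated_def insert_commute)

section \<open>Realising the correlated Gaussian vectors on a product space\<close>

text \<open>One infinite product carries all stages n: each stage reuses the same coordinates, as
  only the law within a stage is prescribed.\<close>

definition iid_std_normal :: "(nat \<Rightarrow> real) measure" where
  "iid_std_normal = (\<Pi>\<^sub>M i\<in>UNIV. std_normal_distribution)"

lemma sets_std_normal_PiM: "sets iid_std_normal = sets (\<Pi>\<^sub>M i\<in>UNIV. borel)"
  unfolding iid_std_normal_def by (intro sets_PiM_cong) auto

lemma measurable_iid_std_normal_component [measurable]:
  "(\<lambda>\<omega>. \<omega> i) \<in> borel_measurable iid_std_normal"
  unfolding measurable_cong_sets[OF sets_std_normal_PiM refl] by measurable

lemma prob_space_std_normal: "prob_space std_normal_distribution"
  using real_dist_normal_dist by (rule real_distribution.axioms)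

interpretation iid: prob_space iid_std_normal
  unfolding iid_std_normal_def by (intro prob_space_PiM prob_space_std_normal)

lemma distr_iid_std_normal_component:
  "distr iid_std_normal borel (\<lambda>\<omega>. \<omega> i) = std_normal_distribution"
proof -
  have "distr iid_std_normal borel (\<lambda>\<omega>. \<omega> i) = distr iid_std_normal std_normal_distribution (\<lambda>\<omega>. \<omega> i)"
    by (intro distr_cong) auto
  thus ?thesis
    unfolding iid_std_normal_def
    by (simp only: distr_PiM_component[where M = "\<lambda>_. std_normal_distribution", OF prob_space_std_normal UNIV_I])
qed

lemma indep_iid_std_normal: "iid.indep_vars (\<lambda>_. borel) (\<lambda>i \<omega>. \<omega> i) UNIV"
proof (subst iid.indep_vars_iff_distr_eq_PiM)
  have "distr iid_std_normal (\<Pi>\<^sub>M i\<in>UNIV. borel) (\<lambda>x. \<lambda>i\<in>UNIV. x i) = iid_std_normal"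
    by (simp add: restrict_UNIV distr_id2 sets_std_normal_PiM)
  thus "distr iid_std_normal (\<Pi>\<^sub>M i\<in>UNIV. borel) (\<lambda>x. \<lambda>i\<in>UNIV. x i) =
      (\<Pi>\<^sub>M i\<in>UNIV. distr iid_std_normal borel (\<lambda>\<omega>. \<omega> i))"
    unfolding distr_iid_std_normal_component by (simp only: iid_std_normal_def)
qed auto

text \<open>The left side is the characteristic function of the weighted sum at 1, which factorises
  by independence; each factor is the standard normal one at \<open>c i\<close>.\<close>

lemma char_iid_std_normal_sum:
  "(CLINT \<omega>|iid_std_normal. iexp (\<Sum>i=1..d. c i * \<omega> i)) = exp (- (\<Sum>i=1..d. (c i)\<^sup>2) / 2)"
proof -
  have indep: "iid.indep_vars (\<lambda>_. borel) (\<lambda>i \<omega>. c i * \<omega> i) {1..d}"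
    using iid.indep_vars_subset[OF indep_iid_std_normal subset_UNIV]
    by (rule iid.indep_vars_compose2[where Y = "\<lambda>i x. c i * x"]) auto
  have comp: "char (distr iid_std_normal borel (\<lambda>\<omega>. c i * \<omega> i)) 1 = exp (- (c i)\<^sup>2 / 2)" for i
  proof -
    have "char (distr iid_std_normal borel (\<lambda>\<omega>. c i * \<omega> i)) 1
        = char (distr iid_std_normal borel (\<lambda>\<omega>. \<omega> i)) (c i)"
      by (simp add: char_def integral_distr)
    thus ?thesis
      by (simp add: distr_iid_std_normal_component char_std_normal_distribution)
  qed
  have "(CLINT \<omega>|iid_std_normal. iexp (\<Sum>i=1..d. c i * \<omega> i))
      = char (distr iid_std_normal borel (\<lambda>\<omega>. \<Sum>i=1..d. c i * \<omega> i)) 1"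
    by (simp add: char_def integral_distr)
  also have "\<dots> = (\<Prod>i=1..d. complex_of_real (exp (- (c i)\<^sup>2 / 2)))"
    unfolding iid.char_distr_sum[OF indep] comp ..
  also have "\<dots> = of_real (exp (\<Sum>i=1..d. - (c i)\<^sup>2 / 2))"
    by (simp only: of_real_prod exp_sum finite_atLeastAtMost)
  finally show ?thesis
    by (simp add: sum_negf flip: sum_divide_distrib)
qed

text \<open>The Cholesky factor of \<open>two_correlated \<rho>\<close> applied to independent
  standard normals.\<close>

definition two_correlated_vector :: "real \<Rightarrow> nat \<Rightarrow> (nat \<Rightarrow> real) \<Rightarrow> real" where
  "two_correlated_vector \<rho> i \<omega> = (if i = 2 then \<rho> * \<omega> 1 + sqrt (1 - \<rho>\<^sup>2) * \<omega> 2 else \<omega> i)"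

lemma centered_gaussian_two_correlated:
  assumes "\<bar>\<rho>\<bar> \<le> 1"
  shows "centered_gaussian iid_std_normal d (two_correlated \<rho>) (two_correlated_vector \<rho>)"
  unfolding centered_gaussian_def
proof (intro conjI ballI allI)
  fix t :: "nat \<Rightarrow> real"
  define s where "s = sqrt (1 - \<rho>\<^sup>2)"
  have s: "s\<^sup>2 = 1 - \<rho>\<^sup>2"
    using assms by (simp add: s_def abs_square_le_1)
  \<comment> \<open>The coefficients of the linear form after rewriting it in the independent
    coordinates, i.e. the transposed Cholesky factor applied to \<open>t\<close>; the sum of their
    squares is the quadratic form. For d < 2 the mixed coordinate 2 lies outside the sum.\<close>
  define c where "c i = (if 2 \<le> d then if i = 1 then t 1 + \<rho> * t 2 else if i = 2 then s * t 2 else t i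
    else t i)" for i
  have lin: "(\<Sum>i=1..d. t i * two_correlated_vector \<rho> i \<omega>) = (\<Sum>i=1..d. c i * \<omega> i)" for \<omega>
  proof -
    have "t i * two_correlated_vector \<rho> i \<omega> = t i * \<omega> i
        + (if i = 2 then t 2 * (\<rho> * \<omega> 1 + (s - 1) * \<omega> 2) else 0)" for i
      by (auto simp: two_correlated_vector_def s_def algebra_simps)
    moreover have "c i * \<omega> i = t i * \<omega> i + (if i = 1 then (if 2 \<le> d then \<rho> * t 2 * \<omega> 1 else 0) else 0)
        + (if i = 2 then (if 2 \<le> d then (s - 1) * t 2 * \<omega> 2 else 0) else 0)" for i
      by (auto simp: c_def algebra_simps)
    ultimately show ?thesis
      by (auto simp: sum.distrib algebra_simps)
  qed
  have "(c i)\<^sup>2 = (t i)\<^sup>2 + (if i = 1 then (if 2 \<le> d then 2 * \<rho> * t 1 * t 2 + \<rho>\<^sup>2 * (t 2)\<^sup>2 else 0) else 0)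
      + (if i = 2 then (if 2 \<le> d then (s\<^sup>2 - 1) * (t 2)\<^sup>2 else 0) else 0)" for i
    by (auto simp: c_def power2_sum power_mult_distrib algebra_simps)
  hence quad: "quad_form d (two_correlated \<rho>) t = (\<Sum>i=1..d. (c i)\<^sup>2)"
    unfolding quad_form_two_correlated by (auto simp: sum.distrib s algebra_simps)
  show "(CLINT \<omega>|iid_std_normal. iexp (\<Sum>i=1..d. t i * two_correlated_vector \<rho> i \<omega>)) =
      complex_of_real (exp (- quad_form d (two_correlated \<rho>) t / 2))"
    unfolding lin quad by (rule char_iid_std_normal_sum)
next
  fix i
  show "two_correlated_vector \<rho> i \<in> borel_measurable iid_std_normal"
    unfolding two_correlated_vector_def by measurable
qed

section \<open>Numbering the upper triangle\<close>

lemma card_upper_triangle: "card {(i, j) \<in> square n. i \<le> j} = triangle n"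
proof -
  have "{(i, j) \<in> square n. i \<le> j} = prod.swap ` (SIGMA j:{1..n}. {1..j})"
    by (auto simp: square_def image_iff)
  hence "card {(i, j) \<in> square n. i \<le> j} = card (SIGMA j:{1..n}. {1..j})"
    by (simp add: card_image)
  also have "\<dots> = (\<Sum>j=1..n. j)"
    by (simp add: card_SigmaI)
  finally show ?thesis
    using gauss_sum_from_Suc_0[of n, where 'a = nat] by (simp add: triangle_def)
qed

lemma exists_upper_triangle_enum:
  "\<exists>h. bij_betw h {(i, j) \<in> square n. i \<le> j} {1..triangle n}"
proof (rule finite_same_card_bij)
  show "finite {(i, j) \<in> square n. i \<le> j}"
    by (rule finite_subset[of _ "square n"]) (auto simp: square_def)
qed (auto simp: card_upper_triangle)

text \<open>An arbitrary numbering suffices: the counterexample only looks up the cells numbered 1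
  and 2.\<close>

definition upper_triangle_enum :: "nat \<Rightarrow> nat \<times> nat \<Rightarrow> nat" where
  "upper_triangle_enum n = (SOME h. bij_betw h {(i, j) \<in> square n. i \<le> j} {1..triangle n})"

lemma bij_upper_triangle_enum:
  "bij_betw (upper_triangle_enum n) {(i, j) \<in> square n. i \<le> j} {1..triangle n}"
  unfolding upper_triangle_enum_def by (rule someI_ex[OF exists_upper_triangle_enum])

lemma gaussian_triangular_scheme_min_max:
  assumes "\<And>n. n \<ge> 1 \<Longrightarrow> centered_gaussian M (triangle n) (S (triangle n)) (Y n)"
  shows "gaussian_triangular_scheme M S (\<lambda>n i j. Y n (upper_triangle_enum n (min i j, max i j)))"
  unfolding gaussian_triangular_scheme_def
proof (intro allI impI exI conjI)
  fix n :: nat assume n: "1 \<le> n"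
  let ?\<phi> = "\<lambda>(i, j). upper_triangle_enum n (min i j, max i j)"
  show "centered_gaussian M (triangle n) (S (triangle n)) (Y n)"
    using assms n .
  show "?\<phi> \<in> square n \<rightarrow> {1..triangle n}"
  proof
    fix x assume "x \<in> square n"
    hence "(min (fst x) (snd x), max (fst x) (snd x)) \<in> {(i, j) \<in> square n. i \<le> j}"
      by (auto simp: square_def min_def max_def)
    from bij_betw_apply[OF bij_upper_triangle_enum this] show "?\<phi> x \<in> {1..triangle n}"
      by (simp add: case_prod_beta)
  qed
  show "bij_betw ?\<phi> {(i, j) \<in> square n. i \<le> j} {1..triangle n}"
    by (rule bij_betw_cong[THEN iffD2, OF _ bij_upper_triangle_enum]) (auto simp: min_def max_def)
  show "\<forall>(i, j)\<in>square n. j < i \<longrightarrow> ?\<phi> (i, j) = ?\<phi> (j, i)"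
    by (simp add: min.commute max.commute)
qed auto

section \<open>The counterexample\<close>

lemma CovMat_two_correlated:
  assumes "\<alpha> > 0"
  shows "(\<lambda>n. two_correlated (real n powr (-\<alpha>))) \<in> CovMat \<alpha>"
  unfolding CovMat_def
proof (intro CollectI allI impI conjI ballI)
  fix n :: nat assume "1 \<le> n"
  show "sym_pos_def n (two_correlated (real n powr (-\<alpha>)))"
  proof (rule sym_pos_def_two_correlated)
    show "real n powr (-\<alpha>) < 1" if "2 \<le> n"
      using powr_less_mono[of "-\<alpha>" 0 "real n"] that assms by simp
  qed auto
qed (auto simp: two_correlated_def)

text \<open>The entries numbered 1 and 2 have covariance \<Delta>_n^(-\<alpha>) >= n^(-2\<alpha>).
  AAU1 for \<alpha>' with two exponents 1 would bound it by C_2 n^(-2\<alpha>'), making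
  n^(2(\<alpha>' - \<alpha>)) bounded.\<close>

lemma not_almost_uncorrelated_two_correlated:
  assumes \<alpha>: "0 < \<alpha>" "\<alpha> < \<alpha>'"
  defines "\<rho> \<equiv> \<lambda>n. real n powr (-\<alpha>)"
  defines "a \<equiv> \<lambda>n i j. two_correlated_vector (\<rho> (triangle n)) (upper_triangle_enum n (min i j, max i j))"
  shows "gaussian_triangular_scheme iid_std_normal (\<lambda>n. two_correlated (\<rho> n)) a"
    and "\<not> almost_uncorrelated iid_std_normal \<alpha>' a"
proof -
  \<comment> \<open>At n = 0 the power is 0 by convention.\<close>
  have \<rho>: "\<bar>\<rho> n\<bar> \<le> 1" for n
    unfolding \<rho>_def using \<alpha> powr_mono[of "-\<alpha>" 0 "real n"] by (cases "n = 0") auto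
  note gauss = centered_gaussian_two_correlated[OF \<rho>]
  show "gaussian_triangular_scheme iid_std_normal (\<lambda>n. two_correlated (\<rho> n)) a"
    unfolding a_def by (intro gaussian_triangular_scheme_min_max gauss)
  show "\<not> almost_uncorrelated iid_std_normal \<alpha>' a"
  proof
    assume "almost_uncorrelated iid_std_normal \<alpha>' a"
    then obtain C where C: "AAU1 iid_std_normal \<alpha>' a C"
      by (auto simp: almost_uncorrelated_def almost_uncorrelated_with_def)
    \<comment> \<open>From n = 2 on, the triangle has at least two cells, so the numbers 1 and 2 are
      both taken.\<close>
    have bound: "real n powr (2 * (\<alpha>' - \<alpha>)) \<le> C 2" if n: "n \<ge> 2" for n
    proof -
      define d where "d = triangle n"
      have "d = (n * n + n) div 2" "4 \<le> n * n" "n \<le> n * n"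
        using n mult_le_mono[of 2 n 2 n] by (auto simp: d_def triangle_def algebra_simps)
      hence d: "2 \<le> d" "d \<le> n\<^sup>2"
        using n unfolding power2_eq_square by linarith+
      interpret gaussian_vector iid_std_normal d "two_correlated (\<rho> d)" "two_correlated_vector (\<rho> d)"
        by unfold_locales (auto simp: two_correlated_def insert_commute gauss)
      have "1 \<in> upper_triangle_enum n ` {(i, j) \<in> square n. i \<le> j}"
           "2 \<in> upper_triangle_enum n ` {(i, j) \<in> square n. i \<le> j}"
        using bij_betw_imp_surj_on[OF bij_upper_triangle_enum[of n]] d by (auto simp: d_def)
      then obtain i1 j1 i2 j2 where ij: "(i1, j1) \<in> square n" "i1 \<le> j1" "upper_triangle_enum n (i1, j1) = 1"
          "(i2, j2) \<in> square n" "i2 \<le> j2" "upper_triangle_enum n (i2, j2) = 2"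
        by (auto simp: image_iff)
      define p q where "p k = (if k = 1 then i1 else i2)" and "q k = (if k = 1 then j1 else j2)" for k :: nat
      have "{i1, j1} \<noteq> {i2, j2}"
        using ij by (auto simp: doubleton_eq_iff)
      hence fd: "fund_diff_pairs n 2 p q"
        using ij(1,4) by (auto simp: fund_diff_pairs_def p_def q_def)
      have two: "{1..2::nat} = {1, 2}"
        by auto
      have "{i \<in> {1..2::nat}. (1::nat) = 1} = {1, 2}"
        by auto
      hence "\<bar>LINT \<omega>|iid_std_normal. a n i1 j1 \<omega> * a n i2 j2 \<omega>\<bar> \<le> C 2 * real n powr (-\<alpha>' * 2)"
        using C[unfolded AAU1_def, rule_format, of n 2 p q "\<lambda>_. 1" n] n fd
        by (simp add: two p_def q_def numeral_2_eq_2)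
      also have "(LINT \<omega>|iid_std_normal. a n i1 j1 \<omega> * a n i2 j2 \<omega>) = moment {#1, 2#}"
        unfolding moment_def monomial_add_mset monomial_empty using ij by (simp add: a_def d_def min_def max_def)
      \<comment> \<open>Wick's recursion has a single summand here: the covariance of coordinates 1
        and 2 times the moment of the empty monomial.\<close>
      also have "\<dots> = \<rho> d"
        using d by (subst wick_recursion) (auto simp: two_correlated_def)
      finally have "\<rho> d \<le> C 2 * real n powr (-\<alpha>' * 2)"
        by simp
      moreover have "real n powr (-\<alpha> * 2) \<le> \<rho> d"
      proof -
        have "real d \<le> real n powr 2"
          using d n by (simp flip: of_nat_power)
        hence "(real n powr 2) powr (-\<alpha>) \<le> real d powr (-\<alpha>)"
          using d \<alpha> by (intro powr_mono2') auto
        thus ?thesis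
          by (simp add: \<rho>_def powr_powr mult.commute del: powr_numeral)
      qed
      ultimately have "real n powr (-\<alpha> * 2) * real n powr (\<alpha>' * 2) \<le>
          C 2 * real n powr (-\<alpha>' * 2) * real n powr (\<alpha>' * 2)"
        by (intro mult_right_mono) auto
      thus ?thesis
        using n by (simp add: mult.assoc algebra_simps flip: powr_add)
    qed
    have "filterlim (\<lambda>n. real n powr (2 * (\<alpha>' - \<alpha>))) at_top sequentially"
      using \<alpha> by real_asymp
    hence "eventually (\<lambda>n. real n powr (2 * (\<alpha>' - \<alpha>)) > C 2 \<and> n \<ge> 2) sequentially"
      by (intro eventually_conj eventually_ge_at_top) (simp add: filterlim_at_top_dense)
    then obtain n where "real n powr (2 * (\<alpha>' - \<alpha>)) > C 2" "n \<ge> 2"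
      by (auto dest: eventually_happens)
    thus False
      using bound[of n] by simp
  qed
qed

theorem theorem3p12:
  shows "(\<forall>(M :: 'w measure) (\<alpha> :: real) S a.
            prob_space M \<and> \<alpha> > 0 \<and> S \<in> CovMat \<alpha> \<and> gaussian_triangular_scheme M S a \<longrightarrow>
              strongly_almost_uncorrelated M \<alpha> a \<and>
              (\<alpha> > 1/4 \<longrightarrow>
                (\<exists>C C' D. strongly_almost_uncorrelated_with M \<alpha> a C C' D \<and>
                   (\<forall>l\<ge>1. summable (C' l) \<and> summable (D l)))))
       \<and> (\<forall>\<alpha>>0. \<forall>\<alpha>'>\<alpha>. \<exists>(M :: (nat \<Rightarrow> real) measure) S a.
            prob_space M \<and> S \<in> CovMat \<alpha> \<and> gaussian_triangular_scheme M S a \<and>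
            \<not> almost_uncorrelated M \<alpha>' a)"
proof (intro conjI allI impI)
  fix M :: "'w measure" and \<alpha> :: real and S a
  assume "prob_space M \<and> \<alpha> > 0 \<and> S \<in> CovMat \<alpha> \<and> gaussian_triangular_scheme M S a"
  then interpret gaussian_scheme M \<alpha> S a
    by (intro gaussian_scheme.intro gaussian_scheme_axioms.intro) simp_all
  obtain C C' D where CD: "strongly_almost_uncorrelated_with M \<alpha> a C C' D"
      "\<alpha> > 1/4 \<longrightarrow> (\<forall>l. summable (C' l) \<and> summable (D l))"
    using strongly_almost_uncorrelated_summable by (elim exE conjE)
  show "strongly_almost_uncorrelated M \<alpha> a"
    unfolding strongly_almost_uncorrelated_def by (intro exI) (rule CD(1))
  show "\<exists>C C' D. strongly_almost_uncorrelated_with M \<alpha> a C C' D \<and>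
      (\<forall>l\<ge>1. summable (C' l) \<and> summable (D l))" if "\<alpha> > 1/4"
    using CD(1) mp[OF CD(2) that] by (intro exI conjI) auto
next
  fix \<alpha> \<alpha>' :: real assume "0 < \<alpha>" "\<alpha> < \<alpha>'"
  note counterexample = not_almost_uncorrelated_two_correlated[OF this]
  show "\<exists>(M :: (nat \<Rightarrow> real) measure) S a. prob_space M \<and> S \<in> CovMat \<alpha> \<and>
      gaussian_triangular_scheme M S a \<and> \<not> almost_uncorrelated M \<alpha>' a"
    by (intro exI conjI) (rule iid.prob_space_axioms CovMat_two_correlated[OF \<open>0 < \<alpha>\<close>] counterexample)+
qed

end
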